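(* Let $\bar\lambda=\langle\lambda_i: i<\kappa\rangle$ be a sequence of infinite regular cardinals, $I^*$ an ideal on $\kappa$ and $\theta$ a cardinal such that at least one of the following holds: ($\alpha$) $\min_{i<\kappa}\lambda_i>\theta\ge \mathrm{wsat}(I^* )$; or ($\beta$) $\liminf_{I^*}(\bar\lambda)\ge\theta\ge\mathrm{wsat}(I^* )$ and $(\prod\bar\lambda,\le_{I^*})$ is $\theta^+$-directed. Then, for infinite cardinals $\lambda$: (1) For every $B\in J_{\le\lambda}[\bar\lambda]\setminus J_{<\lambda}[\bar\lambda]$, $(\prod\bar\lambda\restriction B,<_{J_{<\lambda}[\bar\lambda]})$ has true cofinality $\lambda$ (hence $\lambda$ is regular). (2) If $D$ is an ultrafilter on $\kappa$ with $D\cap I^*=\emptyset$, then $\mathrm{cf}(\prod\bar\lambda/D)=\min\{\lambda: D\cap J_{\le\lambda}[\bar\lambda]\ne\emptyset\}$. (3) (i) For $\lambda$ a limit cardinal, $J_{<\lambda}[\bar\lambda]=\bigcup_{\mu<\lambda}J_{<\mu}[\bar\lambda]$; hence (ii) for every $\lambda$, $J_{<\lambda}[\bar\lambda]=\bigcup_{\mu<\lambda}J_{\le\mu}[\bar\lambda]$. (4) $J_{\le\lambda}[\bar\lambda]\ne J_{<\lambda}[\bar\lambda]$ iff $J_{\le\lambda}[\bar\lambda]\setminus J_{<\lambda}[\bar\lambda]\ne\emptyset$ iff $\lambda\in\mathrm{pcf}(\bar\lambda)$. (5) $J_{\le\lambda}[\bar\lambda]/J_{<\lambda}[\bar\lambda]$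 is $\lambda$-directed, i.e. if $\gamma^*<\lambda$ and $B_\gamma\in J_{\le\lambda}[\bar\lambda]$ for $\gamma<\gamma^*$, then for some $B\in J_{\le\lambda}[\bar\lambda]$ we have $B_\gamma\setminus B\in J_{<\lambda}[\bar\lambda]$ for every $\gamma<\gamma^*$.
   Context: $\kappa$ is an infinite cardinal; $I^*$ is a proper ideal on $\kappa$; $\prod\bar\lambda=\prod_{i<\kappa}\lambda_i$. For an ideal $J$ on $\kappa$ and ordinal-valued functions $f,g$ on $\kappa$: $f<_J g$ means $\{i<\kappa:\neg f(i)<g(i)\}\in J$; similarly $\le_J$. For $B\subseteq\kappa$, $(\prod\bar\lambda\restriction B,<_J)$ is $\prod_{i\in B}\lambda_i$ ordered modulo $J\cap\mathcal P(B)$. For a filter $D$, $<_D$ and $\prod\bar\lambda/D$ refer to the dual ideal. $J^+=\mathcal P(\kappa)\setminus J$. A (quasi-)partial order $P$ is $\lambda$-directed if every $A\subseteq P$ with $|A|<\lambda$ has an upper bound in $P$. $P$ has true cofinality $\lambda$ if there is a strictly increasing sequence $\langle p_\alpha:\alpha<\lambda\rangle$ in $P$ such that every $q\in P$ satisfies $q\le p_\alpha$ for some $\alpha$; $\mathrm{tcf}(P)$ is the least such $\lambda$. $\mathrm{cf}(P)$ is the least size of a cofinal subset. $\liminf_{I}(\bar\lambda)=\min\{\mu:\{i<\kappa:\lambda_i\le\mu\}\in I^+\}$. $\mathrm{wsat}(I)$ is the least cardinal $\theta$ such that $\kappa$ cannot be partitioned into $\theta$ pairwise disjoint sets each in $I^+$.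 $\mathrm{pcf}(\bar\lambda)=\{\mathrm{tcf}(\prod\bar\lambda/D): D$ an ultrafilter on $\kappa$ with $D\cap I^*=\emptyset\}$. $J_{<\lambda}[\bar\lambda]=\{B\subseteq\kappa:$ there is no ultrafilter $D$ on $\kappa$ with $D\cap I^*=\emptyset$, $B\in D$ and $\mathrm{tcf}(\prod\bar\lambda/D)\ge\lambda\}$ (a possibly improper ideal extending $I^*$), and $J_{\le\lambda}[\bar\lambda]=J_{<\lambda^+}[\bar\lambda]$. *)

theory Defs
  imports "HOL-Library.FuncSet" "HOL-Library.Disjoint_Sets"
begin

unbundle cardinal_syntax

text \<open>
  Cardinals are represented, as in the library, by relations \<open>r\<close> with \<^term>\<open>Card_order r\<close>,
  compared by \<open>\<le>o\<close>, \<open><o\<close> and \<open>=o\<close>; the underlying types may differ.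
  An element \<open>a\<close> of \<^term>\<open>Field r\<close> plays the role of the ordinal \<^term>\<open>underS r a\<close>.
\<close>

subsection \<open>Least cardinals\<close>

text \<open>
  Leastness is only tested against cardinals on the same type. For a property \<open>Q\<close> invariant
  under \<open>=o\<close> this is no restriction: every cardinal below \<open>r :: 'c rel\<close> has a copy
  of type \<^typ>\<open>'c rel\<close>.
\<close>

definition is_least_card :: "('c rel \<Rightarrow> bool) \<Rightarrow> 'c rel \<Rightarrow> bool" where
  "is_least_card Q r \<longleftrightarrow>
     Card_order r \<and> Q r \<and> (\<forall>s. Card_order s \<and> Q s \<longrightarrow> r \<le>o s)"

text \<open>Meaningful (and then unique up to \<open>=o\<close>) if some cardinal on the type satisfies \<open>Q\<close>.\<close>

definition least_card :: "('c rel \<Rightarrow> bool) \<Rightarrow> 'c rel" where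
  "least_card Q = (SOME r. is_least_card Q r)"

definition limit_card :: "'c rel \<Rightarrow> bool" where
  "limit_card r \<longleftrightarrow> Card_order r \<and> infinite (Field r) \<and>
     (\<forall>s :: 'c rel. Card_order s \<and> s <o r \<longrightarrow> cardSuc s <o r)"

subsection \<open>Ideals and ultrafilters on a set\<close>

definition ideal_on :: "'k set \<Rightarrow> 'k set set \<Rightarrow> bool" where
  "ideal_on K J \<longleftrightarrow> J \<subseteq> Pow K \<and> {} \<in> J \<and>
     (\<forall>A\<in>J. \<forall>B. B \<subseteq> A \<longrightarrow> B \<in> J) \<and> (\<forall>A\<in>J. \<forall>B\<in>J. A \<union> B \<in> J)"

definition proper_ideal_on :: "'k set \<Rightarrow> 'k set set \<Rightarrow> bool" where
  "proper_ideal_on K J \<longleftrightarrow> ideal_on K J \<and> K \<notin> J"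

definition positive_sets :: "'k set \<Rightarrow> 'k set set \<Rightarrow> 'k set set" where
  "positive_sets K J = Pow K - J"

definition ultrafilter_on :: "'k set \<Rightarrow> 'k set set \<Rightarrow> bool" where
  "ultrafilter_on K D \<longleftrightarrow> D \<subseteq> Pow K \<and> K \<in> D \<and> {} \<notin> D \<and>
     (\<forall>A\<in>D. \<forall>B. A \<subseteq> B \<and> B \<subseteq> K \<longrightarrow> B \<in> D) \<and> (\<forall>A\<in>D. \<forall>B\<in>D. A \<inter> B \<in> D) \<and>
     (\<forall>A. A \<subseteq> K \<longrightarrow> A \<in> D \<or> K - A \<in> D)"

definition dual_ideal :: "'k set \<Rightarrow> 'k set set \<Rightarrow> 'k set set" where
  "dual_ideal K D = {B. B \<subseteq> K \<and> K - B \<in> D}"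

text \<open>
  \<open>wsat\<close> is the least nonzero cardinal \<open>\<theta>\<close> such that \<open>K\<close> has no partition into \<open>\<theta>\<close>
  positive sets; zero has to be excluded because a nonempty set has no partition into zero
  parts. The successor of \<open>|K|\<close> always qualifies and lives on \<^typ>\<open>'k set\<close>.
\<close>

definition wsat :: "'k set \<Rightarrow> 'k set set \<Rightarrow> 'k set rel" where
  "wsat K J = least_card (\<lambda>r. Field r \<noteq> {} \<and>
     \<not> (\<exists>P. partition_on K P \<and> P \<subseteq> positive_sets K J \<and> |P| =o r))"

definition liminf_card :: "'k set \<Rightarrow> 'k set set \<Rightarrow> ('k \<Rightarrow> 'a rel) \<Rightarrow> 'a rel" where
  "liminf_card K J lambar = least_card (\<lambda>r. {i \<in> K. lambar i \<le>o r} \<in> positive_sets K J)"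

subsection \<open>Directedness and cofinality\<close>

text \<open>
  A quasi-order is given by its carrier \<open>P\<close>, its reflexive relation \<open>le\<close> and its strict
  relation \<open>lt\<close>. The latter is a separate argument because \<open><\<close> modulo an ideal is in general
  stronger than \<open>le x y \<and> \<not> le y x\<close>.
\<close>

definition directed_card :: "'p set \<Rightarrow> ('p \<Rightarrow> 'p \<Rightarrow> bool) \<Rightarrow> 'c rel \<Rightarrow> bool" where
  "directed_card P le r \<longleftrightarrow>
     (\<forall>A. A \<subseteq> P \<and> |A| <o r \<longrightarrow> (\<exists>u\<in>P. \<forall>a\<in>A. le a u))"

definition has_true_cofinality ::
    "'p set \<Rightarrow> ('p \<Rightarrow> 'p \<Rightarrow> bool) \<Rightarrow> ('p \<Rightarrow> 'p \<Rightarrow> bool) \<Rightarrow> 'c rel \<Rightarrow> bool" where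
  "has_true_cofinality P le lt r \<longleftrightarrow>
     (\<exists>p. (\<forall>a\<in>Field r. p a \<in> P) \<and>
          (\<forall>a b. (a, b) \<in> r \<and> a \<noteq> b \<longrightarrow> lt (p a) (p b)) \<and>
          (\<forall>q\<in>P. \<exists>a\<in>Field r. le q (p a)))"

text \<open>
  For irreflexive \<open>lt\<close>, a true cofinality is at most \<open>|P|\<close>, so the type \<^typ>\<open>'p\<close> is large enough.
\<close>

definition tcf :: "'p set \<Rightarrow> ('p \<Rightarrow> 'p \<Rightarrow> bool) \<Rightarrow> ('p \<Rightarrow> 'p \<Rightarrow> bool) \<Rightarrow> 'p rel" where
  "tcf P le lt = least_card (has_true_cofinality P le lt)"

definition cf :: "'p set \<Rightarrow> ('p \<Rightarrow> 'p \<Rightarrow> bool) \<Rightarrow> 'p rel" where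
  "cf P le = least_card (\<lambda>r. \<exists>C. C \<subseteq> P \<and> (\<forall>q\<in>P. \<exists>c\<in>C. le q c) \<and> |C| =o r)"

subsection \<open>Products of cardinals modulo an ideal\<close>

definition card_prod :: "'k set \<Rightarrow> ('k \<Rightarrow> 'a rel) \<Rightarrow> ('k \<Rightarrow> 'a) set" where
  "card_prod B lambar = (\<Pi>\<^sub>E i\<in>B. Field (lambar i))"

text \<open>
  The exceptional set is a subset of \<open>B\<close>, so this compares modulo \<^term>\<open>J \<inter> Pow B\<close>.
\<close>

definition le_mod ::
    "'k set \<Rightarrow> ('k \<Rightarrow> 'a rel) \<Rightarrow> 'k set set \<Rightarrow> ('k \<Rightarrow> 'a) \<Rightarrow> ('k \<Rightarrow> 'a) \<Rightarrow> bool" where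
  "le_mod B lambar J f g \<longleftrightarrow> {i \<in> B. \<not> (f i, g i) \<in> lambar i} \<in> J"

definition less_mod ::
    "'k set \<Rightarrow> ('k \<Rightarrow> 'a rel) \<Rightarrow> 'k set set \<Rightarrow> ('k \<Rightarrow> 'a) \<Rightarrow> ('k \<Rightarrow> 'a) \<Rightarrow> bool" where
  "less_mod B lambar J f g \<longleftrightarrow> {i \<in> B. \<not> ((f i, g i) \<in> lambar i \<and> f i \<noteq> g i)} \<in> J"

definition tcf_ultraprod :: "'k set \<Rightarrow> ('k \<Rightarrow> 'a rel) \<Rightarrow> 'k set set \<Rightarrow> ('k \<Rightarrow> 'a) rel" where
  "tcf_ultraprod K lambar D =
     tcf (card_prod K lambar) (le_mod K lambar (dual_ideal K D)) (less_mod K lambar (dual_ideal K D))"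

definition cf_ultraprod :: "'k set \<Rightarrow> ('k \<Rightarrow> 'a rel) \<Rightarrow> 'k set set \<Rightarrow> ('k \<Rightarrow> 'a) rel" where
  "cf_ultraprod K lambar D = cf (card_prod K lambar) (le_mod K lambar (dual_ideal K D))"

subsection \<open>The pcf set and the pcf ideals\<close>

text \<open>As a set of relations, \<open>pcf\<close> contains every copy on \<^typ>\<open>'c\<close> of each of its cardinals.\<close>

definition pcf :: "'k set \<Rightarrow> 'k set set \<Rightarrow> ('k \<Rightarrow> 'a rel) \<Rightarrow> 'c rel set" where
  "pcf K I lambar = {r. Card_order r \<and>
     (\<exists>D. ultrafilter_on K D \<and> D \<inter> I = {} \<and> tcf_ultraprod K lambar D =o r)}"

definition J_less :: "'k set \<Rightarrow> 'k set set \<Rightarrow> ('k \<Rightarrow> 'a rel) \<Rightarrow> 'c rel \<Rightarrow> 'k set set" where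
  "J_less K I lambar r = {B. B \<subseteq> K \<and>
     \<not> (\<exists>D. ultrafilter_on K D \<and> D \<inter> I = {} \<and> B \<in> D \<and> r \<le>o tcf_ultraprod K lambar D)}"

definition J_leq :: "'k set \<Rightarrow> 'k set set \<Rightarrow> ('k \<Rightarrow> 'a rel) \<Rightarrow> 'c rel \<Rightarrow> 'k set set" where
  "J_leq K I lambar r = J_less K I lambar (cardSuc r)"

end

theory Submission
  imports Defs
begin

text \<open>
  Write \<open>J\<close> for \<open>J_less K I lambar lam\<close> and \<open>Prod\<close> for \<open>card_prod K lambar\<close>. The centre of the
  proof is \<open>directed_mod_J_less\<close>: \<open>Prod\<close> is \<open>lam\<close>-directed modulo \<open>J\<close>. It turns membership in the
  pcf ideals into a statement about single ultrafilters: an ultrafilter \<open>D\<close> disjoint from \<open>I\<close>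
  misses \<open>J\<close> if and only if \<open>Prod/D\<close> has true cofinality at least \<open>lam\<close>
  (\<open>disjoint_J_less_iff\<close>). Everything about limits, about \<open>pcf\<close> and about \<open>cf (Prod/D)\<close>
  follows from this equivalence and the ultrafilter lemma.

  Both alternatives of the hypothesis on \<open>\<theta>\<close> give the same three facts, collected in the locale
  \<open>pcf_product\<close>: there are no \<open>\<theta>\<close> many disjoint \<open>I\<close>-positive sets; for \<open>\<xi> < \<theta>\<close>, almost every
  \<open>lambar i\<close> exceeds \<open>|\<xi>|\<close>; and \<open>Prod\<close> is \<open>\<theta>\<^sup>+\<close>-directed modulo \<open>I\<close>.

  The engine is \<open>positive_chain_stops\<close>. Suppose a construction can always be continued, with a
  new lower function \<open>L\<close> that dominates the upper functions \<open>U\<close> of all earlier stages. Along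
  stages \<open>\<xi> < \<theta>\<close> the second fact allows this domination to be pointwise at almost every
  coordinate: there the supremum of fewer than \<open>lambar i\<close> values is taken in the regular cardinal
  \<open>lambar i\<close>. Then for any fixed function \<open>c\<close> the sets \<open>{i. L_\<xi> i < c i \<le> U_\<xi> i}\<close> are disjoint, so
  by the first fact they cannot all be positive. This is used three times.

  \<^item> Directedness modulo \<open>J\<close>: by induction on its size, an unbounded family is replaced by a
    \<open>J\<close>-increasing sequence \<open>f\<close> of regular length greater than \<open>\<theta>\<close>. If \<open>g\<close> does not bound it, some
    ultrafilter with true cofinality at least \<open>lam\<close> contains \<open>{i. g i < f_\<alpha> i}\<close>, and modulo this
    ultrafilter \<open>f\<close> does have a bound \<open>h\<close>. The sets \<open>{i. g i < f_\<beta> i \<le> h i}\<close> are positive for all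
    large \<open>\<beta>\<close>; iterating \<open>g \<mapsto> h\<close> contradicts the engine.

  \<^item> True cofinality on \<open>B\<close> in \<open>J_leq\<close> but not in \<open>J\<close>: if no \<open>J\<close>-increasing sequence \<open>f\<close> of
    length \<open>lam\<close> is cofinal on \<open>B\<close>, then each is bounded by some \<open>h\<close> modulo an ultrafilter that
    contains \<open>B\<close> and misses \<open>J\<close>; its ultraproduct has true cofinality exactly \<open>lam\<close>, so it has a
    cofinal sequence of length \<open>lam\<close>, which the next stage is made to dominate. A common bound of all the
    functions \<open>h\<close> serves as \<open>c\<close>.

  \<^item> Directedness of \<open>J_leq\<close> modulo \<open>J\<close>: dominate the cofinal sequences on the given sets by one
    \<open>J\<close>-increasing sequence \<open>f\<close>. For every \<open>g\<close> and every large \<open>\<alpha>\<close> the set \<open>{i. g i < f_\<alpha> i}\<close> contains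
    all given sets modulo \<open>J\<close>. If it is never in \<open>J_leq\<close>, then modulo some ultrafilter
    containing it the sequence \<open>f\<close> is bounded, and the same climb as in the first case arises.
\<close>

section \<open>Well-orders and cardinals\<close>

text \<open>
  Transfinite constructions are reduced to this choice principle. The relation \<open>Q\<close> compares a new
  value with each earlier one separately, so the step never needs to know how the earlier values
  are related to each other.
\<close>

lemma dependent_choice_along:
  assumes wo: "Well_order r"
    and step: "\<And>a s. a \<in> Field r \<Longrightarrow> (\<And>b. b \<in> underS r a \<Longrightarrow> s b \<in> S b) \<Longrightarrow>
                 \<exists>t\<in>S a. \<forall>b\<in>underS r a. Q a b (s b) t"
  shows "\<exists>s. \<forall>a\<in>Field r. s a \<in> S a \<and> (\<forall>b\<in>underS r a. Q a b (s b) (s a))"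
proof -
  define R where "R = r - Id"
  have wf: "wf R" using wo by (simp add: R_def well_order_on_def)
  define G where "G s a = (SOME t. t \<in> S a \<and> (\<forall>b\<in>underS r a. Q a b (s b) t))" for s a
  define s where "s = wfrec R G"
  have s: "s a = G s a" for a
  proof -
    have "cut s R a b = s b" if "b \<in> underS r a" for b
      using that by (simp add: R_def underS_def cut_def)
    then have "G (cut s R a) a = G s a" by (simp add: G_def)
    then show ?thesis unfolding s_def by (subst wfrec[OF wf])
  qed
  have "a \<in> Field r \<longrightarrow> s a \<in> S a \<and> (\<forall>b\<in>underS r a. Q a b (s b) (s a))" for a
  proof (induction a rule: wf_induct_rule[OF wf])
    case (1 a)
    show ?case
    proof
      assume a: "a \<in> Field r"
      have "s b \<in> S b" if "b \<in> underS r a" for b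
        using that 1[of b] by (auto simp: R_def underS_def Field_def)
      from step[of a s, OF a this]
      have "\<exists>t. t \<in> S a \<and> (\<forall>b\<in>underS r a. Q a b (s b) t)" by auto
      from someI_ex[OF this] show "s a \<in> S a \<and> (\<forall>b\<in>underS r a. Q a b (s b) (s a))"
        unfolding s[of a] G_def .
    qed
  qed
  then show ?thesis by blast
qed

lemma Card_order_Well_order: "Card_order r \<Longrightarrow> Well_order r"
  by (simp add: card_order_on_def)

lemma Well_order_total:
  assumes "Well_order r" "a \<in> Field r" "b \<in> Field r"
  shows "(a, b) \<in> r \<or> (b, a) \<in> r"
  using assms wo_rel.TOTALS[of r] by (auto simp: wo_rel_def)

lemma Well_order_refl: "Well_order r \<Longrightarrow> a \<in> Field r \<Longrightarrow> (a, a) \<in> r"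
  using Well_order_total by fastforce

lemma Well_order_trans: "Well_order r \<Longrightarrow> (a, b) \<in> r \<Longrightarrow> (b, c) \<in> r \<Longrightarrow> (a, c) \<in> r"
  using wo_rel.TRANS[of r] by (auto simp: wo_rel_def dest: transD)

lemma Well_order_antisym: "Well_order r \<Longrightarrow> (a, b) \<in> r \<Longrightarrow> (b, a) \<in> r \<Longrightarrow> a = b"
  using wo_rel.ANTISYM[of r] by (auto simp: wo_rel_def dest: antisymD)

lemma not_ordLeq_imp_ordLess:
  "Card_order r \<Longrightarrow> Card_order s \<Longrightarrow> \<not> r \<le>o s \<Longrightarrow> s <o r"
  using ordLess_or_ordLeq[OF Card_order_Well_order Card_order_Well_order] by blast

text \<open>
  The library calls a set cofinal if it has a member strictly above every element of the field;
  by linearity a set that is not cofinal has a weak upper bound.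
\<close>

lemma regular_bounded:
  assumes r: "Card_order r" "regularCard r" and X: "X \<subseteq> Field r" "|X| <o r"
  shows "\<exists>u\<in>Field r. \<forall>x\<in>X. (x, u) \<in> r"
proof -
  have "\<not> cofinal X r"
    using r X not_ordLess_ordIso unfolding regularCard_def by metis
  then obtain a where a: "a \<in> Field r" "\<And>b. b \<in> X \<Longrightarrow> a = b \<or> (a, b) \<notin> r"
    unfolding cofinal_def by auto
  have "(x, a) \<in> r" if "x \<in> X" for x
    using a(2)[OF that] Well_order_total[OF Card_order_Well_order[OF r(1)] a(1), of x] X(1) that
    by auto
  then show ?thesis using a(1) by auto
qed

lemma card_image_ordLess: "|A| <o r \<Longrightarrow> |f ` A| <o r"
  by (rule ordLeq_ordLess_trans[OF card_of_image])

lemma card_image_Field_ordLeq: "Card_order r \<Longrightarrow> |f ` Field r| \<le>o r"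
  by (rule ordLeq_ordIso_trans[OF card_of_image card_of_Field_ordIso])

lemma card_image_Field_ordLess: "Card_order r \<Longrightarrow> r <o s \<Longrightarrow> |f ` Field r| <o s"
  by (rule ordLeq_ordLess_trans[OF card_image_Field_ordLeq])

lemma card_insert_ordLess:
  assumes "Card_order r" "infinite (Field r)" "|A| <o r"
  shows "|insert x A| <o r"
proof -
  have "|{x}| <o r"
  proof (rule not_ordLeq_imp_ordLess)
    show "\<not> r \<le>o |{x}|"
    proof
      assume "r \<le>o |{x}|"
      then have "|Field r| \<le>o |{x}|" using card_of_mono2 by (fastforce simp: Field_card_of)
      then show False using assms(2) card_of_ordLeq_finite by blast
    qed
  qed (use assms(1) card_of_Card_order in auto)
  then have "|{x} \<union> A| <o r"
    using card_of_Un_ordLess_infinite_Field assms by blast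
  then show ?thesis by simp
qed

text \<open>
  Cardinals on different types are compared throughout; this moves a cardinal to the type on
  which a quantifier in the theorem ranges.
\<close>

lemma cardinal_copy:
  fixes r :: "'a rel" and s :: "'b rel"
  assumes "Card_order r" "Card_order s" "r \<le>o s"
  shows "\<exists>t :: 'b rel. Card_order t \<and> t =o r"
proof -
  have "|Field r| \<le>o s"
    by (rule ordIso_ordLeq_trans[OF card_of_Field_ordIso[OF assms(1)] assms(3)])
  then obtain B :: "'b set" where "|Field r| =o |B|"
    using internalize_card_of_ordLeq[THEN iffD1] by metis
  then have "|B| =o r"
    by (rule ordIso_transitive[OF ordIso_symmetric card_of_Field_ordIso[OF assms(1)]])
  then show ?thesis using card_of_Card_order by blast
qed

lemma is_least_card_least_card:
  assumes "Card_order r" "Q r"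
  shows "is_least_card Q (least_card Q)"
proof -
  have "\<exists>m\<in>{s. Card_order s \<and> Q s}. \<forall>s\<in>{s. Card_order s \<and> Q s}. m \<le>o s"
    using assms by (intro exists_minim_Card_order) auto
  then have "\<exists>m. is_least_card Q m" by (auto simp: is_least_card_def)
  then show ?thesis unfolding least_card_def by (rule someI_ex)
qed

section \<open>Directedness and true cofinality\<close>

lemma directed_card_mono:
  "directed_card P le r \<Longrightarrow> s \<le>o r \<Longrightarrow> directed_card P le s"
  unfolding directed_card_def using ordLess_ordLeq_trans[of _ s r] by blast

lemma directed_card_weaken:
  assumes "directed_card P lt r" "\<And>x y. x \<in> P \<Longrightarrow> y \<in> P \<Longrightarrow> lt x y \<Longrightarrow> le x y"
  shows "directed_card P le r"
  using assms unfolding directed_card_def by (meson subset_iff)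

text \<open>
  A cofinal family indexed by \<open>r\<close> need not be increasing, but \<open>r\<close>-directedness straightens it:
  the \<open>a\<close>-th member of the scale is chosen strictly above the fewer than \<open>r\<close> earlier members and
  above \<open>c a\<close>.
\<close>

lemma true_cofinality_if_directed:
  assumes r: "Card_order r" "infinite (Field r)"
    and dir: "directed_card P lt r"
    and c: "\<And>a. a \<in> Field r \<Longrightarrow> c a \<in> P" "\<And>q. q \<in> P \<Longrightarrow> \<exists>a\<in>Field r. le q (c a)"
    and trans: "\<And>x y z. x \<in> P \<Longrightarrow> y \<in> P \<Longrightarrow> z \<in> P \<Longrightarrow> le x y \<Longrightarrow> le y z \<Longrightarrow> le x z"
    and lt: "\<And>x y. x \<in> P \<Longrightarrow> y \<in> P \<Longrightarrow> lt x y \<Longrightarrow> le x y"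
  shows "has_true_cofinality P le lt r"
proof -
  have "\<exists>p. \<forall>a\<in>Field r. p a \<in> {t \<in> P. le (c a) t} \<and> (\<forall>b\<in>underS r a. lt (p b) (p a))"
  proof (rule dependent_choice_along[OF Card_order_Well_order[OF r(1)]])
    fix a s assume a: "a \<in> Field r" and s: "\<And>b. b \<in> underS r a \<Longrightarrow> s b \<in> {t \<in> P. le (c b) t}"
    have "|insert (c a) (s ` underS r a)| <o r"
      using r a by (intro card_insert_ordLess card_image_ordLess card_of_underS)
    moreover have "insert (c a) (s ` underS r a) \<subseteq> P" using s c(1) a by auto
    ultimately obtain u where "u \<in> P" "\<forall>x\<in>insert (c a) (s ` underS r a). lt x u"
      using dir unfolding directed_card_def by meson
    then show "\<exists>t\<in>{t \<in> P. le (c a) t}. \<forall>b\<in>underS r a. lt (s b) t"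
      using lt c(1) a by auto
  qed
  then obtain p where p: "\<And>a. a \<in> Field r \<Longrightarrow> p a \<in> P \<and> le (c a) (p a)"
    "\<And>a b. a \<in> Field r \<Longrightarrow> b \<in> underS r a \<Longrightarrow> lt (p b) (p a)" by blast
  show ?thesis unfolding has_true_cofinality_def
  proof (intro exI[of _ p] conjI ballI allI impI)
    fix a b assume "(a, b) \<in> r \<and> a \<noteq> b"
    then have "a \<in> underS r b" "b \<in> Field r" by (auto simp: underS_def Field_def)
    then show "lt (p a) (p b)" using p(2) by simp
  next
    fix q assume q: "q \<in> P"
    with c(2) obtain a where "a \<in> Field r" "le q (c a)" by blast
    then show "\<exists>a\<in>Field r. le q (p a)" using p(1) trans q c(1) by blast
  qed (use p in auto)
qed

text \<open>
  The range of a shorter cofinal sequence would be bounded by an element that it cannot reach.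
\<close>

lemma directed_le_true_cofinality:
  assumes r: "Card_order r" and s: "Card_order s" "has_true_cofinality P le lt s"
    and dir: "directed_card P lt r"
    and irr: "\<And>x y. x \<in> P \<Longrightarrow> y \<in> P \<Longrightarrow> lt x y \<Longrightarrow> \<not> le y x"
  shows "r \<le>o s"
proof (rule ccontr)
  assume "\<not> r \<le>o s"
  then have "s <o r" by (rule not_ordLeq_imp_ordLess[OF r s(1)])
  obtain p where p: "\<And>a. a \<in> Field s \<Longrightarrow> p a \<in> P" "\<And>q. q \<in> P \<Longrightarrow> \<exists>a\<in>Field s. le q (p a)"
    using s(2) unfolding has_true_cofinality_def by blast
  have "|p ` Field s| <o r" by (rule card_image_Field_ordLess[OF s(1) \<open>s <o r\<close>])
  moreover have "p ` Field s \<subseteq> P" using p(1) by auto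
  ultimately obtain u where u: "u \<in> P" "\<And>a. a \<in> Field s \<Longrightarrow> lt (p a) u"
    using dir[unfolded directed_card_def, rule_format, OF conjI] by (metis imageI)
  then show False using p irr by blast
qed

text \<open>
  A short cofinal set of indices picks out a short cofinal subfamily, which directedness bounds.
\<close>

lemma regular_if_directed_true_cofinality:
  assumes r: "Card_order r" "has_true_cofinality P le lt r"
    and dir: "directed_card P lt r"
    and trans: "\<And>x y z. x \<in> P \<Longrightarrow> y \<in> P \<Longrightarrow> z \<in> P \<Longrightarrow> le x y \<Longrightarrow> le y z \<Longrightarrow> le x z"
    and lt: "\<And>x y. x \<in> P \<Longrightarrow> y \<in> P \<Longrightarrow> lt x y \<Longrightarrow> le x y"
    and irr: "\<And>x y. x \<in> P \<Longrightarrow> y \<in> P \<Longrightarrow> lt x y \<Longrightarrow> \<not> le y x"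
  shows "regularCard r"
  unfolding regularCard_def
proof (intro allI impI)
  fix X assume X: "X \<subseteq> Field r \<and> cofinal X r"
  obtain p where p: "\<And>a. a \<in> Field r \<Longrightarrow> p a \<in> P" "\<And>q. q \<in> P \<Longrightarrow> \<exists>a\<in>Field r. le q (p a)"
    "\<And>a b. (a, b) \<in> r \<Longrightarrow> a \<noteq> b \<Longrightarrow> lt (p a) (p b)"
    using r(2) unfolding has_true_cofinality_def by blast
  have "|X| \<le>o r"
    using ordLeq_ordIso_trans[OF card_of_mono1 card_of_Field_ordIso[OF r(1)]] X by blast
  moreover have "\<not> |X| <o r"
  proof
    assume "|X| <o r"
    then have "|p ` X| <o r" by (rule card_image_ordLess)
    moreover have "p ` X \<subseteq> P" using p(1) X by auto
    ultimately obtain u where u: "u \<in> P" "\<And>a. a \<in> X \<Longrightarrow> lt (p a) u"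
      using dir[unfolded directed_card_def, rule_format, OF conjI] by (metis imageI)
    obtain a where a: "a \<in> Field r" "le u (p a)" using p(2) u(1) by blast
    obtain b where b: "b \<in> X" "a \<noteq> b" "(a, b) \<in> r"
      using X a(1) unfolding cofinal_def by blast
    have "b \<in> Field r" using b X by auto
    then have "le u (p b)"
      using trans[OF u(1) p(1) p(1) a(2) lt] p(1,3) a(1) b by simp
    then show False using irr[OF p(1) u(1) u(2)] b(1) \<open>b \<in> Field r\<close> by simp
  qed
  ultimately show "|X| =o r" by (simp add: ordLeq_iff_ordLess_or_ordIso)
qed

lemma has_true_cofinality_ordIso:
  assumes s: "has_true_cofinality P le lt s" and iso: "s =o r"
  shows "has_true_cofinality P le lt r"
proof -
  obtain g where g: "bij_betw g (Field r) (Field s)"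
    "\<forall>a\<in>Field r. \<forall>b\<in>Field r. (a, b) \<in> r \<longleftrightarrow> (g a, g b) \<in> s"
    using ordIso_symmetric[OF iso] unfolding ordIso_def iso_iff2 by auto
  obtain p where p: "\<And>a. a \<in> Field s \<Longrightarrow> p a \<in> P" "\<And>q. q \<in> P \<Longrightarrow> \<exists>a\<in>Field s. le q (p a)"
    "\<And>a b. (a, b) \<in> s \<Longrightarrow> a \<noteq> b \<Longrightarrow> lt (p a) (p b)"
    using s unfolding has_true_cofinality_def by blast
  have img: "g ` Field r = Field s" and inj: "inj_on g (Field r)"
    using g(1) by (auto simp: bij_betw_def)
  show ?thesis unfolding has_true_cofinality_def
  proof (intro exI[of _ "\<lambda>a. p (g a)"] conjI ballI allI impI)
    fix a b assume ab: "(a, b) \<in> r \<and> a \<noteq> b"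
    then have "a \<in> Field r" "b \<in> Field r" by (auto simp: Field_def)
    then show "lt (p (g a)) (p (g b))" using ab g(2) inj by (auto intro!: p(3) dest: inj_onD)
  next
    fix q assume "q \<in> P"
    then show "\<exists>a\<in>Field r. le q (p (g a))" using p(2)[of q] img by force
  qed (use p(1) img in auto)
qed

text \<open>
  The abstract form of an ultraproduct of limit ordinals. In such an order an unbounded set is
  already cofinal, so a cofinal set of least size can be straightened into a scale, and cofinality
  and true cofinality coincide.
\<close>

locale unbounded_linear_quasi_order =
  fixes P :: "'p set" and le lt :: "'p \<Rightarrow> 'p \<Rightarrow> bool"
  assumes nonempty: "P \<noteq> {}"
    and trans: "x \<in> P \<Longrightarrow> y \<in> P \<Longrightarrow> z \<in> P \<Longrightarrow> le x y \<Longrightarrow> le y z \<Longrightarrow> le x z"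
    and lt_imp_le: "x \<in> P \<Longrightarrow> y \<in> P \<Longrightarrow> lt x y \<Longrightarrow> le x y"
    and lt_iff: "x \<in> P \<Longrightarrow> y \<in> P \<Longrightarrow> lt x y \<longleftrightarrow> \<not> le y x"
    and no_max: "x \<in> P \<Longrightarrow> \<exists>y\<in>P. lt x y"
begin

lemma is_least_cf:
  "is_least_card (\<lambda>r. \<exists>C. C \<subseteq> P \<and> (\<forall>q\<in>P. \<exists>c\<in>C. le q c) \<and> |C| =o r) (cf P le)"
  unfolding cf_def
proof (rule is_least_card_least_card[of "|P|"])
  have "le q q" if "q \<in> P" for q using lt_imp_le lt_iff that by blast
  then show "\<exists>C. C \<subseteq> P \<and> (\<forall>q\<in>P. \<exists>c\<in>C. le q c) \<and> |C| =o |P|"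
    using card_of_refl by blast
qed (rule card_of_Card_order)

lemma directed_cf: "directed_card P lt (cf P le)"
  unfolding directed_card_def
proof (intro allI impI)
  fix A assume A: "A \<subseteq> P \<and> |A| <o cf P le"
  then have "\<not> (\<forall>q\<in>P. \<exists>c\<in>A. le q c)"
    using is_least_cf card_of_Card_order[of A] card_of_refl[of A] not_ordLess_ordLeq[of "|A|"]
    unfolding is_least_card_def by metis
  then show "\<exists>u\<in>P. \<forall>a\<in>A. lt a u" using lt_iff A by blast
qed

lemma infinite_cf: "infinite (Field (cf P le))"
proof
  assume fin: "finite (Field (cf P le))"
  obtain C where C: "C \<subseteq> P" "\<forall>q\<in>P. \<exists>c\<in>C. le q c" "|C| =o cf P le"
    and co: "Card_order (cf P le)"
    using is_least_cf unfolding is_least_card_def by blast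
  have "finite C"
    using fin card_of_ordIso_finite_Field[OF co ordIso_symmetric[OF C(3)]] by simp
  then have "\<exists>u\<in>P. \<forall>c\<in>C. le c u" using C(1)
  proof (induction C)
    case empty
    then show ?case using nonempty by blast
  next
    case (insert c C)
    then obtain u where u: "u \<in> P" "\<forall>c\<in>C. le c u" by auto
    have cP: "c \<in> P" using insert by auto
    show ?case
    proof (cases "le c u")
      case True
      then show ?thesis using u by auto
    next
      case False
      then have "le u c" using lt_iff lt_imp_le u(1) cP by blast
      moreover have "le c c" using lt_imp_le lt_iff cP by blast
      moreover have "le x c" if "x \<in> C" for x
        using trans[OF _ u(1) cP _ \<open>le u c\<close>] u(2) insert.prems that by auto
      ultimately show ?thesis using cP by blast
    qed
  qed
  then obtain u where u: "u \<in> P" "\<forall>c\<in>C. le c u" by blast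
  obtain v where v: "v \<in> P" "lt u v" using no_max u(1) by blast
  obtain c where "c \<in> C" "le v c" using C(2) v(1) by blast
  then have "le v u" using trans[OF v(1) _ u(1), of c] u(2) C(1) by blast
  then show False using lt_iff u v by blast
qed

lemma is_least_true_cofinality_cf:
  "is_least_card (has_true_cofinality P le lt) (cf P le)"
proof -
  have co: "Card_order (cf P le)" using is_least_cf by (simp add: is_least_card_def)
  obtain C where C: "C \<subseteq> P" "\<forall>q\<in>P. \<exists>c\<in>C. le q c" "|C| =o cf P le"
    using is_least_cf unfolding is_least_card_def by blast
  have "|C| =o |Field (cf P le)|"
    by (rule ordIso_transitive[OF C(3) ordIso_symmetric[OF card_of_Field_ordIso[OF co]]])
  then obtain c where c: "bij_betw c (Field (cf P le)) C"
    using card_of_ordIso[of "Field (cf P le)" C] ordIso_symmetric[of "|C|"] by auto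
  have "has_true_cofinality P le lt (cf P le)"
  proof (rule true_cofinality_if_directed[OF co infinite_cf directed_cf, of c])
    show "\<And>a. a \<in> Field (cf P le) \<Longrightarrow> c a \<in> P" using c C(1) bij_betwE by blast
    show "\<exists>a\<in>Field (cf P le). le q (c a)" if "q \<in> P" for q
      using C(2) c that by (auto simp: bij_betw_def)
    show "\<And>x y z. x \<in> P \<Longrightarrow> y \<in> P \<Longrightarrow> z \<in> P \<Longrightarrow> le x y \<Longrightarrow> le y z \<Longrightarrow> le x z"
      by (rule trans)
    show "\<And>x y. x \<in> P \<Longrightarrow> y \<in> P \<Longrightarrow> lt x y \<Longrightarrow> le x y" by (rule lt_imp_le)
  qed
  moreover have "cf P le \<le>o s" if "Card_order s" "has_true_cofinality P le lt s" for s :: "'p rel"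
    using directed_le_true_cofinality[OF co that directed_cf] lt_iff by blast
  ultimately show ?thesis using co by (auto simp: is_least_card_def)
qed

lemma tcf_ordIso_cf: "tcf P le lt =o cf P le"
  and true_cofinality_tcf: "has_true_cofinality P le lt (tcf P le lt)"
  and Card_order_tcf: "Card_order (tcf P le lt)"
proof -
  have "is_least_card (has_true_cofinality P le lt) (tcf P le lt)"
    unfolding tcf_def
    using is_least_true_cofinality_cf
    by (intro is_least_card_least_card[of "cf P le"]) (simp_all add: is_least_card_def)
  then show "tcf P le lt =o cf P le" "has_true_cofinality P le lt (tcf P le lt)"
    "Card_order (tcf P le lt)"
    using is_least_true_cofinality_cf by (simp_all add: is_least_card_def ordIso_iff_ordLeq)
qed

lemma directed_tcf: "directed_card P lt (tcf P le lt)"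
  by (rule directed_card_mono[OF directed_cf ordIso_imp_ordLeq[OF tcf_ordIso_cf]])

lemma infinite_tcf: "infinite (Field (tcf P le lt))"
  using infinite_cf card_of_ordIso_finite[OF card_of_cong[OF tcf_ordIso_cf]] by blast

end

section \<open>Ideals and ultrafilters\<close>

lemma ideal_on_subset: "ideal_on K J \<Longrightarrow> A \<in> J \<Longrightarrow> B \<subseteq> A \<Longrightarrow> B \<in> J"
  unfolding ideal_on_def by blast

lemma ideal_on_Un: "ideal_on K J \<Longrightarrow> A \<in> J \<Longrightarrow> B \<in> J \<Longrightarrow> A \<union> B \<in> J"
  unfolding ideal_on_def by blast

lemma ideal_on_Pow: "ideal_on K J \<Longrightarrow> A \<in> J \<Longrightarrow> A \<subseteq> K"
  unfolding ideal_on_def by blast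

lemma ideal_on_subset_Un: "ideal_on K J \<Longrightarrow> A \<in> J \<Longrightarrow> B \<in> J \<Longrightarrow> C \<subseteq> A \<union> B \<Longrightarrow> C \<in> J"
  using ideal_on_Un[of K J A B] ideal_on_subset[of K J "A \<union> B" C] by blast

lemma ideal_on_dual_ideal: "ultrafilter_on K D \<Longrightarrow> ideal_on K (dual_ideal K D)"
  unfolding ideal_on_def dual_ideal_def
proof (intro conjI ballI allI impI)
  assume u: "ultrafilter_on K D"
  fix A B assume A: "A \<in> {B. B \<subseteq> K \<and> K - B \<in> D}"
  { assume "B \<subseteq> A"
    then have "K - A \<subseteq> K - B" by blast
    then show "B \<in> {B. B \<subseteq> K \<and> K - B \<in> D}"
      using u A \<open>B \<subseteq> A\<close> unfolding ultrafilter_on_def by (auto 0 3) }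
  { assume B: "B \<in> {B. B \<subseteq> K \<and> K - B \<in> D}"
    have "K - (A \<union> B) = (K - A) \<inter> (K - B)" by blast
    then show "A \<union> B \<in> {B. B \<subseteq> K \<and> K - B \<in> D}"
      using u A B unfolding ultrafilter_on_def by auto }
qed (auto simp: ultrafilter_on_def)

lemma ultrafilter_on_Int: "ultrafilter_on K D \<Longrightarrow> A \<in> D \<Longrightarrow> B \<in> D \<Longrightarrow> A \<inter> B \<in> D"
  by (simp add: ultrafilter_on_def)

lemma ultrafilter_on_superset:
  "ultrafilter_on K D \<Longrightarrow> A \<in> D \<Longrightarrow> A \<subseteq> B \<Longrightarrow> B \<subseteq> K \<Longrightarrow> B \<in> D"
  unfolding ultrafilter_on_def by metis

lemma ultrafilter_on_dichotomy: "ultrafilter_on K D \<Longrightarrow> A \<subseteq> K \<Longrightarrow> A \<in> D \<or> K - A \<in> D"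
  by (simp add: ultrafilter_on_def)

lemma not_in_dual_ideal_iff:
  assumes D: "ultrafilter_on K D" and A: "A \<subseteq> K"
  shows "A \<notin> dual_ideal K D \<longleftrightarrow> A \<in> D"
proof -
  have "A \<inter> (K - A) = {}" by blast
  then have "\<not> (A \<in> D \<and> K - A \<in> D)"
    using ultrafilter_on_Int[OF D, of A "K - A"] D by (auto simp: ultrafilter_on_def)
  then show ?thesis using ultrafilter_on_dichotomy[OF D A] A by (auto simp: dual_ideal_def)
qed

lemma ideal_subset_dual_ideal:
  assumes "ultrafilter_on K D" "ideal_on K J" "D \<inter> J = {}"
  shows "J \<subseteq> dual_ideal K D"
proof
  fix A assume "A \<in> J"
  then show "A \<in> dual_ideal K D"
    using not_in_dual_ideal_iff[OF assms(1), of A] ideal_on_Pow[OF assms(2)] assms(3) by auto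
qed

text \<open>
  The way in which sets are shown to be positive: they contain the intersection of two members of
  an ultrafilter that avoids the ideal.
\<close>

lemma ultrafilter_Int_not_in_ideal:
  assumes "ultrafilter_on K D" "D \<inter> J = {}" "A \<in> D" "B \<in> D" "A \<inter> B \<subseteq> C" "C \<subseteq> K"
  shows "C \<notin> J"
  using ultrafilter_on_superset[OF assms(1) ultrafilter_on_Int[OF assms(1,3,4)] assms(5,6)]
    assms(2) by auto

text \<open>
  Among the ideals that extend \<open>J\<close> and omit \<open>B\<close> take a maximal one, \<open>M\<close>. If neither \<open>A\<close> nor its
  complement were in \<open>M\<close>, then adding either of them would capture \<open>B\<close>, hence \<open>B - A\<close> and \<open>B \<inter> A\<close>
  would be in \<open>M\<close>, and so would \<open>B\<close>. Therefore the complement of \<open>M\<close> is an ultrafilter.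
\<close>

lemma ultrafilter_avoiding_ideal:
  assumes J: "ideal_on K J" and B: "B \<subseteq> K" "B \<notin> J"
  shows "\<exists>D. ultrafilter_on K D \<and> B \<in> D \<and> D \<inter> J = {}"
proof -
  define Z where "Z = {M. ideal_on K M \<and> J \<subseteq> M \<and> B \<notin> M}"
  have "\<exists>M\<in>Z. \<forall>X\<in>Z. M \<subseteq> X \<longrightarrow> X = M"
  proof (rule subset_Zorn_nonempty)
    show "Z \<noteq> {}" using J B by (auto simp: Z_def)
    fix C assume C: "C \<noteq> {}" "subset.chain Z C"
    then have CZ: "C \<subseteq> Z" and tot: "\<And>X Y. X \<in> C \<Longrightarrow> Y \<in> C \<Longrightarrow> X \<subseteq> Y \<or> Y \<subseteq> X"
      by (auto simp: subset_chain_def)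
    have "ideal_on K (\<Union>C)" unfolding ideal_on_def
    proof (intro conjI ballI allI impI)
      show "\<Union>C \<subseteq> Pow K" using CZ by (fastforce simp: Z_def ideal_on_def)
      show "{} \<in> \<Union>C" using CZ C(1) by (fastforce simp: Z_def ideal_on_def)
    next
      fix X Y assume "X \<in> \<Union>C" and YX: "Y \<subseteq> X"
      then obtain U where U: "X \<in> U" "U \<in> C" by blast
      then have "ideal_on K U" using CZ by (auto simp: Z_def)
      then have "Y \<in> U" using U(1) YX by (rule ideal_on_subset)
      then show "Y \<in> \<Union>C" using U(2) by blast
    next
      fix X Y assume "X \<in> \<Union>C" "Y \<in> \<Union>C"
      then obtain U V where "X \<in> U" "U \<in> C" "Y \<in> V" "V \<in> C" by blast
      with tot[of U V] obtain W where "X \<in> W" "Y \<in> W" "W \<in> C" by blast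
      have "ideal_on K W" using \<open>W \<in> C\<close> CZ by (auto simp: Z_def)
      then have "X \<union> Y \<in> W" using \<open>X \<in> W\<close> \<open>Y \<in> W\<close> by (rule ideal_on_Un)
      then show "X \<union> Y \<in> \<Union>C" using \<open>W \<in> C\<close> by blast
    qed
    then show "\<Union>C \<in> Z" using CZ C(1) by (auto simp: Z_def)
  qed
  then obtain M where M: "ideal_on K M" "J \<subseteq> M" "B \<notin> M"
    and max: "\<And>X. ideal_on K X \<Longrightarrow> J \<subseteq> X \<Longrightarrow> B \<notin> X \<Longrightarrow> M \<subseteq> X \<Longrightarrow> X = M"
    unfolding Z_def by auto
  have *: "B - A \<in> M" if A: "A \<subseteq> K" "A \<notin> M" for A
  proof (rule ccontr)
    assume "B - A \<notin> M"
    \<comment> \<open>\<open>N\<close> is the ideal generated by \<open>M\<close> and \<open>A\<close>.\<close>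
    define N where "N = {X. X \<subseteq> K \<and> X - A \<in> M}"
    have sub: "M \<subseteq> N" using ideal_on_Pow[OF M(1)] ideal_on_subset[OF M(1)] unfolding N_def by blast
    have "ideal_on K N" unfolding ideal_on_def
    proof (intro conjI ballI allI impI)
      show "{} \<in> N" using M(1) by (auto simp: N_def ideal_on_def)
    next
      fix X Y assume "X \<in> N" "Y \<subseteq> X"
      then show "Y \<in> N" using ideal_on_subset[OF M(1), of "X - A" "Y - A"] by (auto simp: N_def)
    next
      fix X Y assume "X \<in> N" "Y \<in> N"
      then show "X \<union> Y \<in> N"
        using ideal_on_Un[OF M(1), of "X - A" "Y - A"] by (auto simp: N_def Un_Diff)
    qed (auto simp: N_def)
    moreover have "B \<notin> N" using \<open>B - A \<notin> M\<close> by (auto simp: N_def)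
    ultimately have "N = M" using max sub M(2) by blast
    moreover have "A \<in> N" using A(1) M(1) by (auto simp: N_def ideal_on_def)
    ultimately show False using A(2) by blast
  qed
  define D where "D = Pow K - M"
  have ultra: "A \<in> M \<or> K - A \<in> M" if "A \<subseteq> K" for A
  proof (rule ccontr)
    assume "\<not> ?thesis"
    then have "B - A \<in> M" "B - (K - A) \<in> M" using *[of A] *[of "K - A"] that by auto
    then have "B \<in> M" by (rule ideal_on_subset_Un[OF M(1)]) blast
    then show False using M(3) by blast
  qed
  have nK: "K \<notin> M" using ideal_on_subset[OF M(1), of K B] M(3) B(1) by blast
  have not_both: "\<not> (A \<in> M \<and> K - A \<in> M)" for A
    using nK ideal_on_subset_Un[OF M(1), of A "K - A" K] by blast
  have "ultrafilter_on K D" unfolding ultrafilter_on_def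
  proof (intro conjI ballI allI impI)
    show "K \<in> D" using nK by (simp add: D_def)
    show "{} \<notin> D" using M(1) by (auto simp: D_def ideal_on_def)
  next
    fix A B assume "A \<in> D" "A \<subseteq> B \<and> B \<subseteq> K"
    then show "B \<in> D" using ideal_on_subset[OF M(1)] by (auto simp: D_def)
  next
    fix A B assume AB: "A \<in> D" "B \<in> D"
    then have "K - A \<in> M" "K - B \<in> M" using ultra by (auto simp: D_def)
    then have "K - (A \<inter> B) \<in> M" using ideal_on_Un[OF M(1)] by (metis Diff_Int)
    then show "A \<inter> B \<in> D" using not_both AB by (auto simp: D_def)
  next
    fix A assume "A \<subseteq> K"
    then show "A \<in> D \<or> K - A \<in> D" using not_both by (auto simp: D_def)
  qed (auto simp: D_def)
  then show ?thesis using B M by (intro exI[of _ D]) (auto simp: D_def)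
qed

section \<open>Products of regular cardinals modulo an ideal\<close>

locale regular_product =
  fixes K :: "'k set" and lambar :: "'k \<Rightarrow> 'a rel"
  assumes regular: "i \<in> K \<Longrightarrow> Card_order (lambar i) \<and> infinite (Field (lambar i)) \<and> regularCard (lambar i)"
begin

abbreviation Prod :: "('k \<Rightarrow> 'a) set" where "Prod \<equiv> card_prod K lambar"
abbreviation le where "le \<equiv> le_mod K lambar"
abbreviation lt where "lt \<equiv> less_mod K lambar"

lemma wo: "i \<in> K \<Longrightarrow> Well_order (lambar i)"
  using regular Card_order_Well_order by blast

lemma prod_Field: "f \<in> Prod \<Longrightarrow> i \<in> K \<Longrightarrow> f i \<in> Field (lambar i)"
  by (auto simp: card_prod_def)

lemma pointwise_choice:
  assumes "\<And>i. i \<in> K \<Longrightarrow> \<exists>x\<in>Field (lambar i). Q i x"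
  shows "\<exists>f\<in>Prod. \<forall>i\<in>K. Q i (f i)"
proof -
  obtain f where f: "\<And>i. i \<in> K \<Longrightarrow> f i \<in> Field (lambar i) \<and> Q i (f i)"
    using assms by metis
  then have "restrict f K \<in> Prod" by (auto simp: card_prod_def)
  then show ?thesis using f by (intro bexI[of _ "restrict f K"]) auto
qed

lemma pointwise_successor:
  assumes "f \<in> Prod"
  shows "\<exists>g\<in>Prod. \<forall>i\<in>K. (f i, g i) \<in> lambar i \<and> f i \<noteq> g i"
proof (rule pointwise_choice)
  fix i assume "i \<in> K"
  then show "\<exists>x\<in>Field (lambar i). (f i, x) \<in> lambar i \<and> f i \<noteq> x"
    using infinite_Card_order_limit[of "lambar i" "f i"] regular prod_Field[OF assms] by metis
qed

lemma pointwise_join: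
  assumes "f \<in> Prod" "g \<in> Prod"
  shows "\<exists>h\<in>Prod. \<forall>i\<in>K. (f i, h i) \<in> lambar i \<and> (g i, h i) \<in> lambar i"
proof (rule pointwise_choice)
  fix i assume i: "i \<in> K"
  note F = prod_Field[OF assms(1) i] prod_Field[OF assms(2) i]
  show "\<exists>x\<in>Field (lambar i). (f i, x) \<in> lambar i \<and> (g i, x) \<in> lambar i"
    using Well_order_total[OF wo[OF i] F] F Well_order_refl[OF wo[OF i]] by blast
qed

text \<open>
  A small family has a genuine supremum at each coordinate whose regular factor exceeds the size
  of the family; at the other coordinates the bound is arbitrary.
\<close>

lemma pointwise_bound:
  assumes "A \<subseteq> Prod"
  shows "\<exists>u\<in>Prod. \<forall>i\<in>K. |A| <o lambar i \<longrightarrow> (\<forall>f\<in>A. (f i, u i) \<in> lambar i)"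
proof (rule pointwise_choice)
  fix i assume i: "i \<in> K"
  show "\<exists>x\<in>Field (lambar i). |A| <o lambar i \<longrightarrow> (\<forall>f\<in>A. (f i, x) \<in> lambar i)"
  proof (cases "|A| <o lambar i")
    case True
    then have "|(\<lambda>f. f i) ` A| <o lambar i" by (rule card_image_ordLess)
    moreover have "(\<lambda>f. f i) ` A \<subseteq> Field (lambar i)" using assms prod_Field i by auto
    ultimately obtain u where "u \<in> Field (lambar i)" "\<forall>x\<in>(\<lambda>f. f i) ` A. (x, u) \<in> lambar i"
      using regular_bounded regular[OF i] by metis
    then show ?thesis by auto
  next
    case False
    have "Field (lambar i) \<noteq> {}" using regular[OF i] by auto
    then show ?thesis using False by auto
  qed
qed

lemma prod_nonempty: "Prod \<noteq> {}"
  using pointwise_bound[of "{}"] by auto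

lemma le_if_pointwise:
  assumes "ideal_on K J" "\<And>i. i \<in> K \<Longrightarrow> (f i, g i) \<in> lambar i"
  shows "le J f g"
proof -
  have *: "{i \<in> K. (f i, g i) \<notin> lambar i} = {}" using assms(2) by auto
  show ?thesis unfolding le_mod_def * using assms(1) by (simp add: ideal_on_def)
qed

lemma le_refl: "ideal_on K J \<Longrightarrow> f \<in> Prod \<Longrightarrow> le J f f"
  by (rule le_if_pointwise) (auto intro: Well_order_refl wo prod_Field)

lemma le_trans:
  assumes J: "ideal_on K J" and fg: "le J f g" and gh: "le J g h"
  shows "le J f h"
proof -
  have "(f i, h i) \<in> lambar i"
    if "i \<in> K" "(f i, g i) \<in> lambar i" "(g i, h i) \<in> lambar i" for i
    using Well_order_trans[OF wo[OF that(1)], of "f i" "g i" "h i"]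
      Well_order_antisym[OF wo[OF that(1)], of "f i" "g i"] that(2,3) by auto
  then show ?thesis
    unfolding le_mod_def
    by (intro ideal_on_subset_Un[OF J fg[unfolded le_mod_def] gh[unfolded le_mod_def]]) blast
qed

lemma le_lt_trans:
  assumes J: "ideal_on K J" and fg: "le J f g" and gh: "lt J g h"
  shows "lt J f h"
proof -
  have "(f i, h i) \<in> lambar i \<and> f i \<noteq> h i"
    if "i \<in> K" "(f i, g i) \<in> lambar i" "(g i, h i) \<in> lambar i \<and> g i \<noteq> h i" for i
    using Well_order_trans[OF wo[OF that(1)], of "f i" "g i" "h i"]
      Well_order_antisym[OF wo[OF that(1)], of "f i" "g i"] that(2,3) by auto
  then show ?thesis
    unfolding le_mod_def less_mod_def
    by (intro ideal_on_subset_Un[OF J fg[unfolded le_mod_def less_mod_def] gh[unfolded le_mod_def less_mod_def]]) blast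
qed

lemma lt_le_trans:
  assumes J: "ideal_on K J" and fg: "lt J f g" and gh: "le J g h"
  shows "lt J f h"
proof -
  have "(f i, h i) \<in> lambar i \<and> f i \<noteq> h i"
    if "i \<in> K" "(f i, g i) \<in> lambar i \<and> f i \<noteq> g i" "(g i, h i) \<in> lambar i" for i
    using Well_order_trans[OF wo[OF that(1)], of "f i" "g i" "h i"]
      Well_order_antisym[OF wo[OF that(1)], of "f i" "g i"] that(2,3) by auto
  then show ?thesis
    unfolding le_mod_def less_mod_def
    by (intro ideal_on_subset_Un[OF J fg[unfolded le_mod_def less_mod_def] gh[unfolded le_mod_def less_mod_def]]) blast
qed

lemma lt_imp_le:
  assumes "ideal_on K J" "lt J f g"
  shows "le J f g"
  using assms unfolding le_mod_def less_mod_def by (rule ideal_on_subset) auto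

lemma le_mono: "J \<subseteq> J' \<Longrightarrow> le J f g \<Longrightarrow> le J' f g"
  unfolding le_mod_def by auto

lemma strict_upper_bound_exists:
  assumes J: "ideal_on K J" and u: "u \<in> Prod"
  shows "\<exists>v\<in>Prod. \<forall>f. le J f u \<longrightarrow> lt J f v"
proof -
  obtain v where v: "v \<in> Prod" "\<forall>i\<in>K. (u i, v i) \<in> lambar i \<and> u i \<noteq> v i"
    using pointwise_successor[OF u] by blast
  have *: "{i \<in> K. \<not> ((u i, v i) \<in> lambar i \<and> u i \<noteq> v i)} = {}" using v(2) by auto
  have "lt J u v" unfolding less_mod_def * using J by (simp add: ideal_on_def)
  then show ?thesis using v(1) le_lt_trans[OF J] by auto
qed

lemma directed_lt_if_directed_le:
  assumes J: "ideal_on K J" and dir: "directed_card Prod (le J) r"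
  shows "directed_card Prod (lt J) r"
  unfolding directed_card_def
proof (intro allI impI)
  fix A assume "A \<subseteq> Prod \<and> |A| <o r"
  then obtain u where "u \<in> Prod" "\<forall>f\<in>A. le J f u" using dir unfolding directed_card_def by auto
  then show "\<exists>v\<in>Prod. \<forall>f\<in>A. lt J f v" using strict_upper_bound_exists[OF J, of u] by auto
qed

lemma directed_le_mono:
  "J \<subseteq> J' \<Longrightarrow> directed_card Prod (le J) r \<Longrightarrow> directed_card Prod (le J') r"
  by (erule directed_card_weaken) (rule le_mono)

text \<open>
  Any sequence of length \<open>r\<close> lies below a \<open>J\<close>-increasing one. The domination of \<open>u\<close> is pointwise at
  every coordinate, not merely modulo \<open>J\<close>; this keeps the sets in \<open>positive_chain_stops\<close> disjoint.
\<close>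

lemma increasing_majorant:
  assumes r: "Card_order r" and J: "ideal_on K J" and dir: "directed_card Prod (le J) r"
    and u: "\<And>a. a \<in> Field r \<Longrightarrow> u a \<in> Prod"
  shows "\<exists>f. (\<forall>a\<in>Field r. f a \<in> Prod \<and> (\<forall>i\<in>K. (u a i, f a i) \<in> lambar i)) \<and>
    (\<forall>a b. (b, a) \<in> r \<longrightarrow> le J (f b) (f a))"
proof -
  define S where "S a = {t \<in> Prod. \<forall>i\<in>K. (u a i, t i) \<in> lambar i}" for a
  have "\<exists>f. \<forall>a\<in>Field r. f a \<in> S a \<and> (\<forall>b\<in>underS r a. le J (f b) (f a))"
  proof (rule dependent_choice_along[OF Card_order_Well_order[OF r]])
    fix a s assume a: "a \<in> Field r" and s: "\<And>b. b \<in> underS r a \<Longrightarrow> s b \<in> S b"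
    have "|s ` underS r a| <o r" by (rule card_image_ordLess[OF card_of_underS[OF r a]])
    moreover have "s ` underS r a \<subseteq> Prod" using s by (auto simp: S_def)
    ultimately obtain v where v: "v \<in> Prod" "\<forall>b\<in>underS r a. le J (s b) v"
      using dir unfolding directed_card_def by (metis imageI)
    obtain t where t: "t \<in> Prod" "\<forall>i\<in>K. (u a i, t i) \<in> lambar i \<and> (v i, t i) \<in> lambar i"
      using pointwise_join[OF u[OF a] v(1)] by blast
    have "le J v t" using t(2) by (intro le_if_pointwise[OF J]) auto
    then have "\<forall>b\<in>underS r a. le J (s b) t" using v(2) le_trans[OF J] by blast
    then show "\<exists>t\<in>S a. \<forall>b\<in>underS r a. le J (s b) t" using t by (auto simp: S_def)
  qed
  then obtain f where f: "\<And>a. a \<in> Field r \<Longrightarrow> f a \<in> S a"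
    "\<And>a b. a \<in> Field r \<Longrightarrow> b \<in> underS r a \<Longrightarrow> le J (f b) (f a)" by blast
  have "le J (f b) (f a)" if "(b, a) \<in> r" for a b
  proof (cases "a = b")
    case True
    have "a \<in> Field r" using that by (auto simp: Field_def)
    then show ?thesis using True le_refl[OF J] f(1) by (auto simp: S_def)
  next
    case False
    have "a \<in> Field r" "b \<in> underS r a" using that False by (auto simp: Field_def underS_def)
    then show ?thesis by (rule f(2))
  qed
  then show ?thesis using f(1) by (intro exI[of _ f]) (auto simp: S_def)
qed

subsection \<open>Ultraproducts\<close>

lemma le_dual_iff:
  assumes "ultrafilter_on K D"
  shows "le (dual_ideal K D) f g \<longleftrightarrow> {i \<in> K. (f i, g i) \<in> lambar i} \<in> D"
proof -
  have "K - {i \<in> K. (f i, g i) \<notin> lambar i} = {i \<in> K. (f i, g i) \<in> lambar i}" by auto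
  then show ?thesis by (auto simp: le_mod_def dual_ideal_def)
qed

lemma lt_dual_iff:
  assumes D: "ultrafilter_on K D" and f: "f \<in> Prod" and g: "g \<in> Prod"
  shows "lt (dual_ideal K D) f g \<longleftrightarrow> \<not> le (dual_ideal K D) g f"
proof -
  have "\<not> ((f i, g i) \<in> lambar i \<and> f i \<noteq> g i) \<longleftrightarrow> (g i, f i) \<in> lambar i" if "i \<in> K" for i
    using Well_order_total[OF wo[OF that] prod_Field[OF f that] prod_Field[OF g that]]
      Well_order_antisym[OF wo[OF that], of "f i" "g i"]
      Well_order_refl[OF wo[OF that] prod_Field[OF f that]] by auto
  then have "{i \<in> K. \<not> ((f i, g i) \<in> lambar i \<and> f i \<noteq> g i)} = {i \<in> K. (g i, f i) \<in> lambar i}"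
    by auto
  then show ?thesis
    using not_in_dual_ideal_iff[OF D, of "{i \<in> K. (g i, f i) \<in> lambar i}"]
    by (auto simp: less_mod_def le_dual_iff[OF D])
qed

lemma ultraproduct_linear:
  assumes D: "ultrafilter_on K D"
  shows "unbounded_linear_quasi_order Prod (le (dual_ideal K D)) (lt (dual_ideal K D))"
proof -
  note J = ideal_on_dual_ideal[OF D]
  show ?thesis
  proof
    show "\<exists>y\<in>Prod. lt (dual_ideal K D) x y" if "x \<in> Prod" for x
      using strict_upper_bound_exists[OF J that] le_refl[OF J that] by blast
  qed (use prod_nonempty le_trans[OF J] lt_imp_le[OF J] lt_dual_iff[OF D] in blast)+
qed

lemmas
  Card_order_tcf_ultraprod =
    unbounded_linear_quasi_order.Card_order_tcf[OF ultraproduct_linear, folded tcf_ultraprod_def] and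
  infinite_tcf_ultraprod =
    unbounded_linear_quasi_order.infinite_tcf[OF ultraproduct_linear, folded tcf_ultraprod_def] and
  directed_tcf_ultraprod =
    unbounded_linear_quasi_order.directed_tcf[OF ultraproduct_linear, folded tcf_ultraprod_def] and
  true_cofinality_tcf_ultraprod =
    unbounded_linear_quasi_order.true_cofinality_tcf[OF ultraproduct_linear, folded tcf_ultraprod_def] and
  tcf_ordIso_cf_ultraprod =
    unbounded_linear_quasi_order.tcf_ordIso_cf[OF ultraproduct_linear,
      folded tcf_ultraprod_def cf_ultraprod_def]

text \<open>
  Ultraproducts bound families smaller than their cofinality: an unbounded family in a linear
  order is cofinal.
\<close>

lemma bounded_mod_ultrafilter:
  assumes D: "ultrafilter_on K D" and A: "A \<subseteq> Prod" "|A| <o tcf_ultraprod K lambar D"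
  shows "\<exists>u\<in>Prod. \<forall>f\<in>A. le (dual_ideal K D) f u"
proof -
  obtain u where "u \<in> Prod" "\<forall>f\<in>A. lt (dual_ideal K D) f u"
    using directed_tcf_ultraprod[OF D] A unfolding directed_card_def by blast
  then show ?thesis using lt_imp_le[OF ideal_on_dual_ideal[OF D]] by blast
qed

lemma le_tcf_if_directed:
  assumes D: "ultrafilter_on K D" and r: "Card_order r"
    and dir: "directed_card Prod (le (dual_ideal K D)) r"
  shows "r \<le>o tcf_ultraprod K lambar D"
  by (rule directed_le_true_cofinality[OF r Card_order_tcf_ultraprod[OF D]
        true_cofinality_tcf_ultraprod[OF D]
        directed_lt_if_directed_le[OF ideal_on_dual_ideal[OF D] dir]])
    (simp add: lt_dual_iff[OF D])

end

section \<open>Directedness modulo the pcf ideals\<close>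

text \<open>
  The three facts that both alternatives of the hypothesis on \<open>\<theta>\<close> have in common. The second one
  says that \<open>lambar i\<close> exceeds the cardinality of any given ordinal below \<open>\<theta>\<close>, outside a set in \<open>I\<close>.
\<close>

locale pcf_product = regular_product K lambar
  for K :: "'k set" and lambar :: "'k \<Rightarrow> 'a rel" +
  fixes I :: "'k set set" and \<theta> :: "'t rel"
  assumes ideal_I: "ideal_on K I"
    and Card_order_\<theta>: "Card_order \<theta>"
    and no_disjoint_positive:
      "\<And>A. (\<And>a. a \<in> Field \<theta> \<Longrightarrow> A a \<subseteq> K \<and> A a \<notin> I) \<Longrightarrow>
        (\<And>a b. a \<in> Field \<theta> \<Longrightarrow> b \<in> Field \<theta> \<Longrightarrow> a \<noteq> b \<Longrightarrow> A a \<inter> A b = {}) \<Longrightarrow> False"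
    and small_factors: "a \<in> Field \<theta> \<Longrightarrow> {i \<in> K. lambar i \<le>o |underS \<theta> a|} \<in> I"
    and directed_mod_I: "directed_card Prod (le I) (cardSuc \<theta>)"
begin

text \<open>
  Call the states \<open>s a\<close>, with \<open>a\<close> below \<open>\<theta>\<close>. If \<open>i\<close> were in the sets for \<open>b < a\<close> at the same \<open>x\<close> and \<open>c\<close>,
  then \<open>c i \<le> U (s b) x i \<le> L (s a) x i < c i\<close> as long as \<open>lambar i\<close> exceeds the cardinality of \<open>a\<close>.
  Discarding the coordinates with small factors changes each set only by a member of \<open>I\<close> and makes
  the sets disjoint. The index \<open>x\<close> and the function \<open>c\<close> may be chosen after the whole chain, which is
  what allows both to depend on all of its stages.
\<close>

lemma positive_chain_stops:
  fixes L U :: "'s \<Rightarrow> 'x \<Rightarrow> 'k \<Rightarrow> 'a"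
  assumes ext: "\<And>a s. a \<in> Field \<theta> \<Longrightarrow> (\<And>b. b \<in> underS \<theta> a \<Longrightarrow> s b \<in> S) \<Longrightarrow>
      \<exists>t\<in>S. \<forall>b\<in>underS \<theta> a. \<forall>x\<in>X. \<forall>i\<in>K. |underS \<theta> a| <o lambar i \<longrightarrow>
        (U (s b) x i, L t x i) \<in> lambar i"
  shows "\<exists>s. (\<forall>a\<in>Field \<theta>. s a \<in> S) \<and>
    (\<forall>x\<in>X. \<forall>c. \<exists>a\<in>Field \<theta>.
      {i \<in> K. (c i, U (s a) x i) \<in> lambar i \<and> (c i, L (s a) x i) \<notin> lambar i} \<in> I)"
proof -
  have "\<exists>s. \<forall>a\<in>Field \<theta>. s a \<in> S \<and> (\<forall>b\<in>underS \<theta> a. \<forall>x\<in>X. \<forall>i\<in>K.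
      |underS \<theta> a| <o lambar i \<longrightarrow> (U (s b) x i, L (s a) x i) \<in> lambar i)"
    by (rule dependent_choice_along[OF Card_order_Well_order[OF Card_order_\<theta>]]) (rule ext)
  then obtain s where s: "\<And>a. a \<in> Field \<theta> \<Longrightarrow> s a \<in> S"
    and s_le: "\<And>a b x i. a \<in> Field \<theta> \<Longrightarrow> b \<in> underS \<theta> a \<Longrightarrow> x \<in> X \<Longrightarrow> i \<in> K \<Longrightarrow>
      |underS \<theta> a| <o lambar i \<Longrightarrow> (U (s b) x i, L (s a) x i) \<in> lambar i"
    by blast
  have "\<exists>a\<in>Field \<theta>. {i \<in> K. (c i, U (s a) x i) \<in> lambar i \<and> (c i, L (s a) x i) \<notin> lambar i} \<in> I"
    (is "\<exists>a\<in>_. ?A a \<in> I") if x: "x \<in> X" for x c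
  proof (rule ccontr)
    assume "\<not> (\<exists>a\<in>Field \<theta>. ?A a \<in> I)"
    then have pos: "?A a \<notin> I" if "a \<in> Field \<theta>" for a using that by blast
    define B where "B a = {i \<in> ?A a. |underS \<theta> a| <o lambar i}" for a
    have disj: "B a \<inter> B b = {}" if a: "a \<in> Field \<theta>" and ab: "b \<in> underS \<theta> a" for a b
    proof (rule ccontr)
      assume "B a \<inter> B b \<noteq> {}"
      then obtain i where i: "i \<in> K" "|underS \<theta> a| <o lambar i" "(c i, L (s a) x i) \<notin> lambar i"
        "(c i, U (s b) x i) \<in> lambar i" by (auto simp: B_def)
      then show False
        using Well_order_trans[OF wo[OF i(1)] i(4) s_le[OF a ab x i(1,2)]] by simp
    qed
    show False
    proof (rule no_disjoint_positive[of B])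
      fix a assume a: "a \<in> Field \<theta>"
      have "B a \<notin> I"
      proof
        assume "B a \<in> I"
        then have "?A a \<in> I" using small_factors[OF a]
        proof (rule ideal_on_subset_Un[OF ideal_I], intro subsetI)
          fix i assume i: "i \<in> ?A a"
          then have "lambar i \<le>o |underS \<theta> a| \<or> |underS \<theta> a| <o lambar i"
            using not_ordLeq_imp_ordLess card_of_Card_order regular[of i] by auto
          then show "i \<in> B a \<union> {i \<in> K. lambar i \<le>o |underS \<theta> a| }"
            using i by (auto simp: B_def)
        qed
        then show False using pos[OF a] by blast
      qed
      then show "B a \<subseteq> K \<and> B a \<notin> I" by (auto simp: B_def)
    next
      fix a b assume ab: "a \<in> Field \<theta>" "b \<in> Field \<theta>" "a \<noteq> b"
      then have "a \<in> underS \<theta> b \<or> b \<in> underS \<theta> a"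
        using Well_order_total[OF Card_order_Well_order[OF Card_order_\<theta>]]
        by (auto simp: underS_def)
      then show "B a \<inter> B b = {}" using disj[of a b] disj[of b a] ab by auto
    qed
  qed
  then show ?thesis using s by (intro exI[of _ s]) auto
qed

lemma bound_choices_below_regular:
  assumes r: "Card_order r" "regularCard r" "\<theta> <o r"
    and \<alpha>: "\<And>a. a \<in> Field \<theta> \<Longrightarrow> \<alpha> a \<in> Field r"
  shows "\<exists>u\<in>Field r. \<forall>a\<in>Field \<theta>. (\<alpha> a, u) \<in> r"
proof -
  have "|\<alpha> ` Field \<theta>| <o r" by (rule card_image_Field_ordLess[OF Card_order_\<theta> r(3)])
  moreover have "\<alpha> ` Field \<theta> \<subseteq> Field r" using \<alpha> by auto
  ultimately obtain u where "u \<in> Field r" "\<forall>x\<in>\<alpha> ` Field \<theta>. (x, u) \<in> r"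
    using regular_bounded[OF r(1,2)] by metis
  then show ?thesis by auto
qed

text \<open>
  The threshold \<open>\<alpha>\<close> may depend on \<open>g\<close>. Along a chain of \<open>\<theta>\<close> functions the thresholds have a common
  bound in the regular cardinal \<open>r\<close>, and the corresponding member of the sequence \<open>f\<close> is the single
  comparison function at which the chain has to stop.
\<close>

lemma no_perpetual_climb:
  assumes r: "Card_order r" "regularCard r" "\<theta> <o r"
    and climb: "\<And>g. g \<in> Prod \<Longrightarrow> \<exists>h\<in>Prod. \<exists>\<alpha>\<in>Field r. \<forall>\<beta>. (\<alpha>, \<beta>) \<in> r \<longrightarrow>
      {i \<in> K. (f \<beta> i, h i) \<in> lambar i \<and> (f \<beta> i, g i) \<notin> lambar i} \<notin> I"
  shows False
proof -
  define good where "good g h \<alpha> \<longleftrightarrow> h \<in> Prod \<and> \<alpha> \<in> Field r \<and> (\<forall>\<beta>. (\<alpha>, \<beta>) \<in> r \<longrightarrow>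
      {i \<in> K. (f \<beta> i, h i) \<in> lambar i \<and> (f \<beta> i, g i) \<notin> lambar i} \<notin> I)" for g h \<alpha>
  have "\<forall>g\<in>Prod. \<exists>p. good g (fst p) (snd p)"
    using climb unfolding good_def split_paired_Ex fst_conv snd_conv by blast
  then obtain p where p: "\<forall>g\<in>Prod. good g (fst (p g)) (snd (p g))" by (rule bchoice[THEN exE])
  define h where "h g = fst (p g)" for g
  define \<alpha> where "\<alpha> g = snd (p g)" for g
  have h: "\<And>g. g \<in> Prod \<Longrightarrow> h g \<in> Prod" "\<And>g. g \<in> Prod \<Longrightarrow> \<alpha> g \<in> Field r"
    "\<And>g \<beta>. g \<in> Prod \<Longrightarrow> (\<alpha> g, \<beta>) \<in> r \<Longrightarrow>
      {i \<in> K. (f \<beta> i, h g i) \<in> lambar i \<and> (f \<beta> i, g i) \<notin> lambar i} \<notin> I"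
    using p by (auto simp: good_def h_def \<alpha>_def)
  have "\<exists>s. (\<forall>a\<in>Field \<theta>. s a \<in> Prod) \<and> (\<forall>x\<in>{()}. \<forall>c. \<exists>a\<in>Field \<theta>.
      {i \<in> K. (c i, h (s a) i) \<in> lambar i \<and> (c i, s a i) \<notin> lambar i} \<in> I)"
  proof (rule positive_chain_stops[where L = "\<lambda>g x. g" and U = "\<lambda>g x. h g"])
    fix a and s :: "'t \<Rightarrow> 'k \<Rightarrow> 'a"
    assume s: "\<And>b. b \<in> underS \<theta> a \<Longrightarrow> s b \<in> Prod"
    have "(\<lambda>b. h (s b)) ` underS \<theta> a \<subseteq> Prod" using s h(1) by auto
    from pointwise_bound[OF this] obtain t where t: "t \<in> Prod"
      "\<And>i b. i \<in> K \<Longrightarrow> |(\<lambda>b. h (s b)) ` underS \<theta> a| <o lambar i \<Longrightarrow> b \<in> underS \<theta> a \<Longrightarrow>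
        (h (s b) i, t i) \<in> lambar i" by auto
    then show "\<exists>t\<in>Prod. \<forall>b\<in>underS \<theta> a. \<forall>x\<in>{()}. \<forall>i\<in>K. |underS \<theta> a| <o lambar i \<longrightarrow>
        (h (s b) i, t i) \<in> lambar i"
      by (auto dest: card_image_ordLess intro!: bexI[of _ t])
  qed
  then obtain s where s: "\<And>a. a \<in> Field \<theta> \<Longrightarrow> s a \<in> Prod"
    and stop: "\<And>c. \<exists>a\<in>Field \<theta>.
      {i \<in> K. (c i, h (s a) i) \<in> lambar i \<and> (c i, s a i) \<notin> lambar i} \<in> I" by blast
  obtain u where u: "\<forall>a\<in>Field \<theta>. (\<alpha> (s a), u) \<in> r"
    using bound_choices_below_regular[OF r, of "\<lambda>a. \<alpha> (s a)"] h(2)[OF s] by auto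
  obtain a where a: "a \<in> Field \<theta>"
    "{i \<in> K. (f u i, h (s a) i) \<in> lambar i \<and> (f u i, s a i) \<notin> lambar i} \<in> I"
    using stop[of "f u"] by (rule bexE)
  have "(\<alpha> (s a), u) \<in> r" using u a(1) by (rule bspec)
  from h(3)[OF s[OF a(1)] this] a(2) show False by (rule notE)
qed

lemma J_lessI:
  assumes "B \<subseteq> K"
    and "\<And>D. ultrafilter_on K D \<Longrightarrow> D \<inter> I = {} \<Longrightarrow> B \<in> D \<Longrightarrow> \<not> r \<le>o tcf_ultraprod K lambar D"
  shows "B \<in> J_less K I lambar r"
  using assms unfolding J_less_def by blast

lemma J_lessD:
  assumes "B \<in> J_less K I lambar r" "ultrafilter_on K D" "D \<inter> I = {}" "B \<in> D"
  shows "\<not> r \<le>o tcf_ultraprod K lambar D"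
  using assms unfolding J_less_def by blast

lemma J_less_subset: "B \<in> J_less K I lambar r \<Longrightarrow> B \<subseteq> K"
  unfolding J_less_def by blast

lemma not_in_J_lessE:
  assumes "B \<subseteq> K" "B \<notin> J_less K I lambar r"
  obtains D where "ultrafilter_on K D" "D \<inter> I = {}" "B \<in> D" "r \<le>o tcf_ultraprod K lambar D"
  using assms J_lessI by blast

lemma ideal_J_less: "ideal_on K (J_less K I lambar r)"
  unfolding ideal_on_def
proof (intro conjI ballI allI impI)
  show "J_less K I lambar r \<subseteq> Pow K" using J_less_subset by blast
  show "{} \<in> J_less K I lambar r" by (rule J_lessI) (simp_all add: ultrafilter_on_def)
next
  fix A B assume A: "A \<in> J_less K I lambar r" and BA: "B \<subseteq> A"
  show "B \<in> J_less K I lambar r"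
  proof (rule J_lessI)
    show "B \<subseteq> K" using J_less_subset[OF A] BA by simp
    fix D assume D: "ultrafilter_on K D" "D \<inter> I = {}" "B \<in> D"
    show "\<not> r \<le>o tcf_ultraprod K lambar D"
      using J_lessD[OF A D(1,2)] ultrafilter_on_superset[OF D(1,3) BA J_less_subset[OF A]] by simp
  qed
next
  fix A B assume AB: "A \<in> J_less K I lambar r" "B \<in> J_less K I lambar r"
  note sub = J_less_subset[OF AB(1)] J_less_subset[OF AB(2)]
  show "A \<union> B \<in> J_less K I lambar r"
  proof (rule J_lessI)
    show "A \<union> B \<subseteq> K" using sub by simp
    fix D assume D: "ultrafilter_on K D" "D \<inter> I = {}" "A \<union> B \<in> D"
    have "A \<in> D \<or> B \<in> D"
    proof (rule ccontr)
      assume "\<not> (A \<in> D \<or> B \<in> D)"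
      then have "A \<in> dual_ideal K D" "B \<in> dual_ideal K D"
        using not_in_dual_ideal_iff[OF D(1) sub(1)] not_in_dual_ideal_iff[OF D(1) sub(2)] by blast+
      then have "A \<union> B \<in> dual_ideal K D" by (rule ideal_on_Un[OF ideal_on_dual_ideal[OF D(1)]])
      then show False using not_in_dual_ideal_iff[OF D(1), of "A \<union> B"] D(3) sub by simp
    qed
    then show "\<not> r \<le>o tcf_ultraprod K lambar D"
      using J_lessD[OF AB(1) D(1,2)] J_lessD[OF AB(2) D(1,2)] by blast
  qed
qed

lemma I_subset_J_less: "I \<subseteq> J_less K I lambar r"
proof
  fix B assume "B \<in> I"
  then show "B \<in> J_less K I lambar r"
    using ideal_on_Pow[OF ideal_I] by (intro J_lessI) blast+
qed

lemma finite_bounded: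
  assumes J: "ideal_on K J" and "finite A" "A \<subseteq> Prod"
  shows "\<exists>u\<in>Prod. \<forall>f\<in>A. le J f u"
  using assms(2,3)
proof (induction A)
  case empty
  then show ?case using prod_nonempty by auto
next
  case (insert f A)
  then obtain u where u: "u \<in> Prod" "\<forall>f\<in>A. le J f u" by auto
  obtain v where v: "v \<in> Prod" "\<forall>i\<in>K. (f i, v i) \<in> lambar i \<and> (u i, v i) \<in> lambar i"
    using pointwise_join[of f u] insert.prems u(1) by auto
  have "le J f v" "le J u v" using v(2) by (auto intro: le_if_pointwise[OF J])
  then show ?case using u(2) v(1) le_trans[OF J] by (intro bexI[of _ v]) auto
qed

text \<open>
  Produces one step of a climb. The sequence is bounded by \<open>h\<close> modulo \<open>D\<close> because it is short,
  and since it increases modulo \<open>D\<close> it stays above \<open>g\<close> from \<open>\<alpha>\<close> on; both events are in \<open>D\<close>, hence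
  positive.
\<close>

lemma climb_mod_ultrafilter:
  assumes D: "ultrafilter_on K D" "D \<inter> I = {}" and JD: "J \<subseteq> dual_ideal K D"
    and f: "\<And>a. a \<in> Field r \<Longrightarrow> f a \<in> Prod" "|f ` Field r| <o tcf_ultraprod K lambar D"
    and mono: "\<And>a b. (b, a) \<in> r \<Longrightarrow> le J (f b) (f a)"
    and above: "{i \<in> K. (f \<alpha> i, g i) \<notin> lambar i} \<in> D"
  shows "\<exists>h\<in>Prod. \<forall>\<beta>. (\<alpha>, \<beta>) \<in> r \<longrightarrow>
    {i \<in> K. (f \<beta> i, h i) \<in> lambar i \<and> (f \<beta> i, g i) \<notin> lambar i} \<notin> I"
proof -
  have "f ` Field r \<subseteq> Prod" using f(1) by auto
  then obtain h where h: "h \<in> Prod" "\<And>a. a \<in> Field r \<Longrightarrow> le (dual_ideal K D) (f a) h"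
    using bounded_mod_ultrafilter[OF D(1), of "f ` Field r"] f(2) by auto
  have "{i \<in> K. (f \<beta> i, h i) \<in> lambar i \<and> (f \<beta> i, g i) \<notin> lambar i} \<notin> I"
    if \<beta>: "(\<alpha>, \<beta>) \<in> r" for \<beta>
  proof (rule ultrafilter_Int_not_in_ideal[OF D])
    have "\<beta> \<in> Field r" using \<beta> by (rule FieldI2)
    then have "{i \<in> K. (f \<beta> i, h i) \<in> lambar i} \<in> D" using h(2) le_dual_iff[OF D(1)] by simp
    moreover have "{i \<in> K. (f \<alpha> i, f \<beta> i) \<in> lambar i} \<in> D"
      using le_mono[OF JD mono[OF \<beta>]] le_dual_iff[OF D(1)] by simp
    ultimately show "{i \<in> K. (f \<beta> i, h i) \<in> lambar i} \<inter> {i \<in> K. (f \<alpha> i, f \<beta> i) \<in> lambar i} \<in> D"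
      by (rule ultrafilter_on_Int[OF D(1)])
  qed (use above Well_order_trans[OF wo] in auto)
  then show ?thesis using h(1) by blast
qed

text \<open>
  Induction on the size of the family \<open>A\<close>. Families of size at most \<open>\<theta>\<close> are bounded modulo \<open>I\<close> by
  hypothesis. For singular size, \<open>A\<close> is a union of few smaller families, and their bounds form a
  smaller family. For regular size above \<open>\<theta>\<close>, the induction hypothesis replaces \<open>A\<close>, well-ordered by
  its own cardinal, by an increasing sequence; a family without a bound then admits a perpetual
  climb, because each failure \<open>{i. g i < f \<alpha> i}\<close> outside \<open>J_less\<close> belongs to an ultrafilter of true
  cofinality at least \<open>r\<close>, modulo which the sequence is bounded.
\<close>

theorem directed_mod_J_less:
  assumes r: "Card_order r"
  shows "directed_card Prod (le (J_less K I lambar r)) r"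
proof -
  define J where "J = J_less K I lambar r"
  have J: "ideal_on K J" unfolding J_def by (rule ideal_J_less)
  have "\<exists>u\<in>Prod. \<forall>f\<in>A. le J f u" if "A \<subseteq> Prod" "|A| <o r" for A
    using that
  proof (induction "|A|" arbitrary: A rule: wf_induct_rule[OF wf_ordLess])
    case (1 A)
    note A = 1(2) and Ar = 1(3)
    have IH: "\<exists>u\<in>Prod. \<forall>f\<in>B. le J f u" if "B \<subseteq> Prod" "|B| <o |A|" for B
      by (rule 1(1)[OF that(2,1) ordLess_transitive[OF that(2) Ar]])
    consider "finite A" | "|A| \<le>o \<theta>" | "infinite A" "\<theta> <o |A|" "\<not> regularCard |A|"
      | "infinite A" "\<theta> <o |A|" "regularCard |A|"
      using not_ordLeq_imp_ordLess[OF card_of_Card_order Card_order_\<theta>, of A] by blast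
    then show ?case
    proof cases
      case 1
      then show ?thesis using finite_bounded[OF J] A by blast
    next
      case 2
      then have "|A| <o cardSuc \<theta>"
        using cardSuc_ordLeq_ordLess[OF Card_order_\<theta> card_of_Card_order] by blast
      then obtain u where "u \<in> Prod" "\<forall>f\<in>A. le I f u"
        using directed_mod_I A unfolding directed_card_def by blast
      then show ?thesis using le_mono[OF I_subset_J_less] unfolding J_def by blast
    next
      case 3
      then obtain X where X: "X \<subseteq> A" "cofinal X |A|" "\<not> |X| =o |A|"
        by (auto simp: regularCard_def Field_card_of)
      then have XA: "|X| <o |A|"
        using card_of_mono1[OF X(1)] by (simp add: ordLeq_iff_ordLess_or_ordIso)
      have "\<exists>u\<in>Prod. \<forall>f\<in>underS |A| x. le J f u" if "x \<in> X" for x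
      proof (rule IH)
        show "|underS |A| x| <o |A|"
          using X(1) that by (intro card_of_underS[OF card_of_Card_order]) (auto simp: Field_card_of)
        show "underS |A| x \<subseteq> Prod"
          using A by (auto simp: underS_def dest!: FieldI1 simp: Field_card_of)
      qed
      then obtain g where g: "\<And>x. x \<in> X \<Longrightarrow> g x \<in> Prod"
        "\<And>x f. x \<in> X \<Longrightarrow> f \<in> underS |A| x \<Longrightarrow> le J f (g x)" by metis
      have "\<exists>u\<in>Prod. \<forall>f\<in>g ` X. le J f u"
      proof (rule IH)
        show "|g ` X| <o |A|" by (rule card_image_ordLess[OF XA])
      qed (use g(1) in auto)
      then obtain u where u: "u \<in> Prod" "\<And>x. x \<in> X \<Longrightarrow> le J (g x) u" by auto
      have "le J f u" if "f \<in> A" for f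
      proof -
        obtain x where "x \<in> X" "f \<noteq> x" "(f, x) \<in> |A|"
          using X(2) \<open>f \<in> A\<close> unfolding cofinal_def by (auto simp: Field_card_of)
        then show ?thesis using le_trans[OF J g(2) u(2)] by (simp add: underS_def)
      qed
      then show ?thesis using u(1) by blast
    next
      case 4
      have dir: "directed_card Prod (le J) |A|" unfolding directed_card_def using IH by blast
      have id: "a \<in> Prod" if "a \<in> Field |A|" for a using that A by (auto simp: Field_card_of)
      obtain f where "(\<forall>a\<in>Field |A|. f a \<in> Prod \<and> (\<forall>i\<in>K. (a i, f a i) \<in> lambar i)) \<and>
          (\<forall>a b. (b, a) \<in> |A| \<longrightarrow> le J (f b) (f a))"
        using increasing_majorant[where u = "\<lambda>a. a", OF card_of_Card_order J dir id] by (rule exE)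
      then have f': "\<forall>a\<in>Field |A|. f a \<in> Prod \<and> (\<forall>i\<in>K. (a i, f a i) \<in> lambar i)"
        and mono': "\<forall>a b. (b, a) \<in> |A| \<longrightarrow> le J (f b) (f a)"
        by (rule conjunct1, rule conjunct2)
      have f: "\<And>a. a \<in> A \<Longrightarrow> f a \<in> Prod" "\<And>a i. a \<in> A \<Longrightarrow> i \<in> K \<Longrightarrow> (a i, f a i) \<in> lambar i"
        and mono: "\<And>a b. (b, a) \<in> |A| \<Longrightarrow> le J (f b) (f a)"
        using f' mono' by (simp_all add: Field_card_of)
      show ?thesis
      proof (rule ccontr)
        assume unbounded: "\<not> ?thesis"
        show False
        proof (rule no_perpetual_climb[OF card_of_Card_order 4(3,2)])
          fix g assume g: "g \<in> Prod"
          have "\<exists>\<alpha>\<in>A. \<not> le J (f \<alpha>) g"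
          proof (rule ccontr)
            assume "\<not> ?thesis"
            then have "le J a g" if "a \<in> A" for a
              using le_trans[OF J le_if_pointwise[OF J f(2)[OF that]]] that by simp
            then show False using unbounded g by blast
          qed
          then obtain \<alpha> where \<alpha>: "\<alpha> \<in> A" "{i \<in> K. (f \<alpha> i, g i) \<notin> lambar i} \<notin> J"
            by (auto simp: le_mod_def)
          have "{i \<in> K. (f \<alpha> i, g i) \<notin> lambar i} \<subseteq> K" by blast
          then obtain D where D: "ultrafilter_on K D" "D \<inter> I = {}"
            and \<alpha>D: "{i \<in> K. (f \<alpha> i, g i) \<notin> lambar i} \<in> D"
            and tcf: "r \<le>o tcf_ultraprod K lambar D"
            by (rule not_in_J_lessE[OF _ \<alpha>(2)[unfolded J_def]])
          have "D \<inter> J = {}" using J_lessD[OF _ D] tcf unfolding J_def by blast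
          then have JD: "J \<subseteq> dual_ideal K D" by (rule ideal_subset_dual_ideal[OF D(1) J])
          have "|f ` Field |A| | <o tcf_ultraprod K lambar D"
            by (rule card_image_Field_ordLess[OF card_of_Card_order ordLess_ordLeq_trans[OF Ar tcf]])
          from climb_mod_ultrafilter[where f = f and g = g and \<alpha> = \<alpha>, OF D JD _ this mono \<alpha>D] f(1)
          show "\<exists>h\<in>Prod. \<exists>\<alpha>\<in>Field |A|. \<forall>\<beta>. (\<alpha>, \<beta>) \<in> |A| \<longrightarrow>
              {i \<in> K. (f \<beta> i, h i) \<in> lambar i \<and> (f \<beta> i, g i) \<notin> lambar i} \<notin> I"
            using \<alpha>(1) by (auto simp: Field_card_of)
        qed
      qed
    qed
  qed
  then show ?thesis unfolding directed_card_def J_def by blast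
qed

lemma disjoint_J_less_iff:
  assumes D: "ultrafilter_on K D" "D \<inter> I = {}" and r: "Card_order r"
  shows "D \<inter> J_less K I lambar r = {} \<longleftrightarrow> r \<le>o tcf_ultraprod K lambar D"
proof
  assume "D \<inter> J_less K I lambar r = {}"
  then have "J_less K I lambar r \<subseteq> dual_ideal K D"
    by (rule ideal_subset_dual_ideal[OF D(1) ideal_J_less])
  then show "r \<le>o tcf_ultraprod K lambar D"
    by (intro le_tcf_if_directed[OF D(1) r] directed_le_mono[OF _ directed_mod_J_less[OF r]])
next
  assume "r \<le>o tcf_ultraprod K lambar D"
  then show "D \<inter> J_less K I lambar r = {}" using J_lessD[OF _ D] by blast
qed

lemma disjoint_J_leq_iff:
  assumes D: "ultrafilter_on K D" "D \<inter> I = {}" and r: "Card_order r"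
  shows "D \<inter> J_leq K I lambar r = {} \<longleftrightarrow> r <o tcf_ultraprod K lambar D"
  unfolding J_leq_def disjoint_J_less_iff[OF D cardSuc_Card_order[OF r]]
  by (rule cardSuc_ordLess_ordLeq[OF r Card_order_tcf_ultraprod[OF D(1)], symmetric])

text \<open>
  Needed to make room for \<open>\<theta>\<close> many thresholds below a regular true cofinality.
\<close>

lemma \<theta>_less_tcf:
  assumes D: "ultrafilter_on K D" "D \<inter> I = {}"
  shows "\<theta> <o tcf_ultraprod K lambar D"
proof -
  have "cardSuc \<theta> \<le>o tcf_ultraprod K lambar D"
    by (intro le_tcf_if_directed[OF D(1) cardSuc_Card_order[OF Card_order_\<theta>]]
        directed_le_mono[OF _ directed_mod_I] ideal_subset_dual_ideal[OF D(1) ideal_I D(2)])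
  then show ?thesis
    using cardSuc_ordLess_ordLeq[OF Card_order_\<theta> Card_order_tcf_ultraprod[OF D(1)]] by blast
qed

section \<open>The structure of the pcf ideals\<close>

lemma J_less_mono:
  "r \<le>o s \<Longrightarrow> J_less K I lambar r \<subseteq> J_less K I lambar s"
  unfolding J_less_def using ordLeq_transitive[of r s] by blast

lemma tcf_ordIso_if_in_J_leq:
  assumes D: "ultrafilter_on K D" "D \<inter> I = {}" and r: "Card_order r"
    and J: "D \<inter> J_less K I lambar r = {}" and B: "B \<in> D" "B \<in> J_leq K I lambar r"
  shows "tcf_ultraprod K lambar D =o r"
proof -
  have "r \<le>o tcf_ultraprod K lambar D" using disjoint_J_less_iff[OF D r] J by simp
  moreover have "\<not> r <o tcf_ultraprod K lambar D" using disjoint_J_leq_iff[OF D r] B by blast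
  ultimately show ?thesis
    using ordLeq_iff_ordLess_or_ordIso[of r] ordIso_symmetric[of r] by blast
qed

lemma ultraproduct_scale:
  assumes D: "ultrafilter_on K D" and r: "Card_order r" and tcf: "tcf_ultraprod K lambar D =o r"
  shows "has_true_cofinality Prod (le (dual_ideal K D)) (lt (dual_ideal K D)) r" "regularCard r"
proof -
  note J = ideal_on_dual_ideal[OF D]
  show *: "has_true_cofinality Prod (le (dual_ideal K D)) (lt (dual_ideal K D)) r"
    using has_true_cofinality_ordIso[OF true_cofinality_tcf_ultraprod[OF D] tcf] .
  show "regularCard r"
  proof (rule regular_if_directed_true_cofinality[OF r *])
    show "directed_card Prod (lt (dual_ideal K D)) r"
      by (rule directed_card_mono[OF directed_tcf_ultraprod[OF D]
            ordIso_imp_ordLeq[OF ordIso_symmetric[OF tcf]]])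
  qed (use le_trans[OF J] lt_imp_le[OF J] lt_dual_iff[OF D] in blast)+
qed

lemma regular_if_new_set:
  assumes r: "Card_order r" and B: "B \<in> J_leq K I lambar r - J_less K I lambar r"
  shows "regularCard r" "\<theta> <o r"
proof -
  have "B \<subseteq> K" using B J_less_subset unfolding J_leq_def by blast
  then obtain D where D: "ultrafilter_on K D" "D \<inter> I = {}" "B \<in> D"
    "r \<le>o tcf_ultraprod K lambar D"
    using B by (elim not_in_J_lessE[of B r]) auto
  then have tcf: "tcf_ultraprod K lambar D =o r"
    using tcf_ordIso_if_in_J_leq[OF D(1,2) r _ D(3)] disjoint_J_less_iff[OF D(1,2) r] B by blast
  show "regularCard r" by (rule ultraproduct_scale(2)[OF D(1) r tcf])
  show "\<theta> <o r" by (rule ordLess_ordIso_trans[OF \<theta>_less_tcf[OF D(1,2)] tcf])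
qed

text \<open>
  If \<open>h\<close> is not bounded on \<open>B\<close> by any member of the increasing sequence \<open>f\<close>, then the sets
  \<open>{i \<in> B. f \<alpha> i < h i}\<close> are positive and decrease modulo the ideal, so one ultrafilter contains them
  all while missing the ideal. It contains \<open>B\<close>, and this pins its true cofinality to \<open>r\<close>.
\<close>

lemma ultrafilter_on_new_set:
  assumes r: "Card_order r" "infinite (Field r)"
    and B: "B \<in> J_leq K I lambar r - J_less K I lambar r"
    and f: "\<And>\<alpha> \<beta>. (\<alpha>, \<beta>) \<in> r \<Longrightarrow> le (J_less K I lambar r) (f \<alpha>) (f \<beta>)"
    and h: "\<And>\<alpha>. \<alpha> \<in> Field r \<Longrightarrow> {i \<in> B. (h i, f \<alpha> i) \<notin> lambar i} \<notin> J_less K I lambar r"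
  shows "\<exists>D. ultrafilter_on K D \<and> D \<inter> I = {} \<and> tcf_ultraprod K lambar D =o r \<and>
    (\<forall>\<alpha>\<in>Field r. {i \<in> K. (h i, f \<alpha> i) \<notin> lambar i} \<in> D)"
proof -
  define J where "J = J_less K I lambar r"
  have J: "ideal_on K J" unfolding J_def by (rule ideal_J_less)
  have BK: "B \<subseteq> K" using B J_less_subset unfolding J_leq_def by blast
  define P where "P \<alpha> = {i \<in> B. (h i, f \<alpha> i) \<notin> lambar i}" for \<alpha>
  have P_mono: "P \<beta> - P \<alpha> \<in> J" if "(\<alpha>, \<beta>) \<in> r" for \<alpha> \<beta>
  proof (rule ideal_on_subset[OF J])
    show "{i \<in> K. (f \<alpha> i, f \<beta> i) \<notin> lambar i} \<in> J"
      using f[OF that] by (simp add: le_mod_def J_def)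
    show "P \<beta> - P \<alpha> \<subseteq> {i \<in> K. (f \<alpha> i, f \<beta> i) \<notin> lambar i}"
    proof
      fix i assume i: "i \<in> P \<beta> - P \<alpha>"
      then have "i \<in> K" "(h i, f \<alpha> i) \<in> lambar i" "(h i, f \<beta> i) \<notin> lambar i"
        using BK by (auto simp: P_def)
      then show "i \<in> {i \<in> K. (f \<alpha> i, f \<beta> i) \<notin> lambar i}"
        using Well_order_trans[OF wo, of i "h i" "f \<alpha> i" "f \<beta> i"] by blast
    qed
  qed
  \<comment> \<open>The sets that \<open>D\<close> has to avoid: those negligible on some \<open>P \<alpha>\<close>.\<close>
  define M where "M = {X. X \<subseteq> K \<and> (\<exists>\<alpha>\<in>Field r. X \<inter> P \<alpha> \<in> J)}"
  have M_up: "X \<inter> P \<beta> \<in> J" if "X \<inter> P \<alpha> \<in> J" "(\<alpha>, \<beta>) \<in> r" for X \<alpha> \<beta>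
    by (rule ideal_on_subset_Un[OF J that(1) P_mono[OF that(2)]]) blast
  have r_ne: "Field r \<noteq> {}" using r(2) by auto
  have JM: "J \<subseteq> M"
  proof
    fix X assume X: "X \<in> J"
    obtain \<alpha> where "\<alpha> \<in> Field r" using r_ne by blast
    moreover have "X \<inter> P \<alpha> \<in> J" using ideal_on_subset[OF J X] by blast
    ultimately show "X \<in> M" using ideal_on_Pow[OF J X] by (auto simp: M_def)
  qed
  have "ideal_on K M" unfolding ideal_on_def
  proof (intro conjI ballI allI impI)
    show "M \<subseteq> Pow K" by (auto simp: M_def)
    show "{} \<in> M" using JM J by (auto simp: ideal_on_def)
  next
    fix X Y assume X: "X \<in> M" and YX: "Y \<subseteq> X"
    then obtain \<alpha> where \<alpha>: "\<alpha> \<in> Field r" "X \<inter> P \<alpha> \<in> J" "X \<subseteq> K" by (auto simp: M_def)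
    have "Y \<inter> P \<alpha> \<in> J" using YX by (intro ideal_on_subset[OF J \<alpha>(2)]) blast
    then show "Y \<in> M" using \<alpha> YX by (auto simp: M_def)
  next
    fix X Y assume "X \<in> M" "Y \<in> M"
    then obtain \<alpha> \<beta> where \<alpha>: "\<alpha> \<in> Field r" "X \<inter> P \<alpha> \<in> J" "X \<subseteq> K"
      and \<beta>: "\<beta> \<in> Field r" "Y \<inter> P \<beta> \<in> J" "Y \<subseteq> K" by (auto simp: M_def)
    have "\<exists>\<gamma>\<in>Field r. (\<alpha>, \<gamma>) \<in> r \<and> (\<beta>, \<gamma>) \<in> r"
      using Well_order_total[OF Card_order_Well_order[OF r(1)] \<alpha>(1) \<beta>(1)]
        Well_order_refl[OF Card_order_Well_order[OF r(1)]] \<alpha>(1) \<beta>(1) by blast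
    then obtain \<gamma> where \<gamma>: "\<gamma> \<in> Field r" "(\<alpha>, \<gamma>) \<in> r" "(\<beta>, \<gamma>) \<in> r" by blast
    have "(X \<union> Y) \<inter> P \<gamma> \<in> J"
      by (rule ideal_on_subset_Un[OF J M_up[OF \<alpha>(2) \<gamma>(2)] M_up[OF \<beta>(2) \<gamma>(3)]]) blast
    then show "X \<union> Y \<in> M" using \<gamma>(1) \<alpha>(3) \<beta>(3) by (auto simp: M_def)
  qed
  moreover have "B \<notin> M"
  proof
    assume "B \<in> M"
    then obtain \<alpha> where "\<alpha> \<in> Field r" "B \<inter> P \<alpha> \<in> J" by (auto simp: M_def)
    moreover have "B \<inter> P \<alpha> = P \<alpha>" by (auto simp: P_def)
    ultimately show False using h by (simp add: P_def J_def)
  qed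
  ultimately obtain D where D: "ultrafilter_on K D" "B \<in> D" "D \<inter> M = {}"
    using ultrafilter_avoiding_ideal[OF _ BK] by blast
  have DJ: "D \<inter> J = {}" using D(3) JM by blast
  then have DI: "D \<inter> I = {}" using I_subset_J_less unfolding J_def by blast
  have "tcf_ultraprod K lambar D =o r"
    by (rule tcf_ordIso_if_in_J_leq[OF D(1) DI r(1) DJ[unfolded J_def] D(2)]) (use B in blast)
  moreover have "{i \<in> K. (h i, f \<alpha> i) \<notin> lambar i} \<in> D" if \<alpha>: "\<alpha> \<in> Field r" for \<alpha>
  proof (rule ultrafilter_on_superset[OF D(1)])
    have *: "(K - P \<alpha>) \<inter> P \<alpha> = {}" by blast
    have "(K - P \<alpha>) \<inter> P \<alpha> \<in> J" unfolding * using J by (simp add: ideal_on_def)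
    then have "K - P \<alpha> \<in> M" using \<alpha> unfolding M_def by blast
    then have "K - P \<alpha> \<notin> D" using D(3) by blast
    moreover have "P \<alpha> \<subseteq> K" using BK by (auto simp: P_def)
    ultimately show "P \<alpha> \<in> D" using ultrafilter_on_dichotomy[OF D(1)] by blast
  qed (use BK in \<open>auto simp: P_def\<close>)
  ultimately show ?thesis using D(1) DI by blast
qed

text \<open>
  The states of the chain are the \<open>J\<close>-increasing sequences \<open>f\<close> of length \<open>r\<close>. As no \<open>f\<close> is cofinal on
  \<open>B\<close>, each comes with a function \<open>h\<close> above all of \<open>f\<close> modulo some ultrafilter \<open>D\<close>, and with a scale
  \<open>k\<close> of length \<open>r\<close> in the ultraproduct by \<open>D\<close>; the next state must dominate \<open>k\<close>. A bound \<open>c\<close> of all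
  functions \<open>h\<close> along the chain, which exists by \<open>\<theta>\<^sup>+\<close>-directedness, lies above every \<open>f\<close> modulo its
  \<open>D\<close> but is overtaken by its \<open>k\<close>, and one index \<open>\<beta>\<close> works for all stages because \<open>r\<close> is regular and
  greater than \<open>\<theta>\<close>. Hence the sets at \<open>\<beta>\<close> and \<open>c\<close> are all positive, contradicting
  \<open>positive_chain_stops\<close>.
\<close>

lemma cofinal_sequence_on_new_set:
  assumes r: "Card_order r" "infinite (Field r)"
    and B: "B \<in> J_leq K I lambar r - J_less K I lambar r"
  shows "\<exists>f. (\<forall>\<alpha>\<in>Field r. f \<alpha> \<in> Prod) \<and>
    (\<forall>\<alpha> \<beta>. (\<alpha>, \<beta>) \<in> r \<longrightarrow> le (J_less K I lambar r) (f \<alpha>) (f \<beta>)) \<and>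
    (\<forall>q\<in>Prod. \<exists>\<alpha>\<in>Field r. {i \<in> B. (q i, f \<alpha> i) \<notin> lambar i} \<in> J_less K I lambar r)"
proof (rule ccontr)
  assume no_sequence: "\<not> ?thesis"
  define J where "J = J_less K I lambar r"
  have J: "ideal_on K J" unfolding J_def by (rule ideal_J_less)
  have dir: "directed_card Prod (le J) r" unfolding J_def by (rule directed_mod_J_less[OF r(1)])
  define S where "S = {f. (\<forall>\<alpha>\<in>Field r. f \<alpha> \<in> Prod) \<and> (\<forall>\<alpha> \<beta>. (\<alpha>, \<beta>) \<in> r \<longrightarrow> le J (f \<alpha>) (f \<beta>))}"
  \<comment> \<open>The witnesses attached to a state, to be fixed once for each state by choice.\<close>
  define good where "good f h D k \<longleftrightarrow> h \<in> Prod \<and> ultrafilter_on K D \<and> D \<inter> I = {} \<and>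
    (\<forall>\<alpha>\<in>Field r. {i \<in> K. (h i, f \<alpha> i) \<notin> lambar i} \<in> D) \<and>
    (\<forall>\<alpha>\<in>Field r. k \<alpha> \<in> Prod) \<and>
    (\<forall>\<alpha> \<beta>. (\<alpha>, \<beta>) \<in> r \<longrightarrow> \<alpha> \<noteq> \<beta> \<longrightarrow> lt (dual_ideal K D) (k \<alpha>) (k \<beta>)) \<and>
    (\<forall>q\<in>Prod. \<exists>\<alpha>\<in>Field r. le (dual_ideal K D) q (k \<alpha>))" for f h D k
  have "\<exists>h D k. good f h D k" if f: "f \<in> S" for f
  proof -
    have "\<exists>h\<in>Prod. \<forall>\<alpha>\<in>Field r. {i \<in> B. (h i, f \<alpha> i) \<notin> lambar i} \<notin> J"
      using no_sequence f unfolding S_def J_def by blast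
    then obtain h where h: "h \<in> Prod" "\<And>\<alpha>. \<alpha> \<in> Field r \<Longrightarrow> {i \<in> B. (h i, f \<alpha> i) \<notin> lambar i} \<notin> J"
      by blast
    obtain D where D: "ultrafilter_on K D" "D \<inter> I = {}" "tcf_ultraprod K lambar D =o r"
      "\<forall>\<alpha>\<in>Field r. {i \<in> K. (h i, f \<alpha> i) \<notin> lambar i} \<in> D"
      using ultrafilter_on_new_set[OF r B, of f h] f h(2) unfolding S_def J_def by blast
    obtain k where "(\<forall>a\<in>Field r. k a \<in> Prod) \<and>
      (\<forall>a b. (a, b) \<in> r \<and> a \<noteq> b \<longrightarrow> lt (dual_ideal K D) (k a) (k b)) \<and>
      (\<forall>q\<in>Prod. \<exists>a\<in>Field r. le (dual_ideal K D) q (k a))"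
      using ultraproduct_scale(1)[OF D(1) r(1) D(3)] unfolding has_true_cofinality_def by (rule exE)
    then have "good f h D k" using h(1) D unfolding good_def by blast
    then show ?thesis by blast
  qed
  then have "\<forall>f\<in>S. \<exists>p. good f (fst p) (fst (snd p)) (snd (snd p))"
    unfolding split_paired_Ex fst_conv snd_conv by blast
  then obtain p where p: "\<forall>f\<in>S. good f (fst (p f)) (fst (snd (p f))) (snd (snd (p f)))"
    by (rule bchoice[THEN exE])
  define h where "h f = fst (p f)" for f
  define D where "D f = fst (snd (p f))" for f
  define k where "k f = snd (snd (p f))" for f
  have h: "\<And>f. f \<in> S \<Longrightarrow> h f \<in> Prod"
    and D: "\<And>f. f \<in> S \<Longrightarrow> ultrafilter_on K (D f)" "\<And>f. f \<in> S \<Longrightarrow> D f \<inter> I = {}"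
    and hD: "\<And>f \<alpha>. f \<in> S \<Longrightarrow> \<alpha> \<in> Field r \<Longrightarrow> {i \<in> K. (h f i, f \<alpha> i) \<notin> lambar i} \<in> D f"
    and k: "\<And>f \<alpha>. f \<in> S \<Longrightarrow> \<alpha> \<in> Field r \<Longrightarrow> k f \<alpha> \<in> Prod"
      "\<And>f \<alpha> \<beta>. f \<in> S \<Longrightarrow> (\<alpha>, \<beta>) \<in> r \<Longrightarrow> \<alpha> \<noteq> \<beta> \<Longrightarrow> lt (dual_ideal K (D f)) (k f \<alpha>) (k f \<beta>)"
      "\<And>f q. f \<in> S \<Longrightarrow> q \<in> Prod \<Longrightarrow> \<exists>\<alpha>\<in>Field r. le (dual_ideal K (D f)) q (k f \<alpha>)"
    using p unfolding good_def h_def D_def k_def by simp_all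
  have "\<exists>s. (\<forall>a\<in>Field \<theta>. s a \<in> S) \<and> (\<forall>\<alpha>\<in>Field r. \<forall>c. \<exists>a\<in>Field \<theta>.
      {i \<in> K. (c i, k (s a) \<alpha> i) \<in> lambar i \<and> (c i, s a \<alpha> i) \<notin> lambar i} \<in> I)"
  proof (rule positive_chain_stops[where L = "\<lambda>f. f"])
    fix a s assume s: "\<And>b. b \<in> underS \<theta> a \<Longrightarrow> s b \<in> S"
    have "\<exists>u\<in>Prod. \<forall>b\<in>underS \<theta> a. \<forall>i\<in>K. |underS \<theta> a| <o lambar i \<longrightarrow>
        (k (s b) \<alpha> i, u i) \<in> lambar i" if \<alpha>: "\<alpha> \<in> Field r" for \<alpha>
    proof -
      have "(\<lambda>b. k (s b) \<alpha>) ` underS \<theta> a \<subseteq> Prod" using s k(1) \<alpha> by auto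
      then obtain u where u: "u \<in> Prod" "\<And>i b. i \<in> K \<Longrightarrow>
          |(\<lambda>b. k (s b) \<alpha>) ` underS \<theta> a| <o lambar i \<Longrightarrow> b \<in> underS \<theta> a \<Longrightarrow>
          (k (s b) \<alpha> i, u i) \<in> lambar i" using pointwise_bound by (metis imageI)
      then show ?thesis using u by (intro bexI[of _ u]) (simp_all add: card_image_ordLess)
    qed
    then have "\<forall>\<alpha>\<in>Field r. \<exists>u. u \<in> Prod \<and> (\<forall>b\<in>underS \<theta> a. \<forall>i\<in>K.
        |underS \<theta> a| <o lambar i \<longrightarrow> (k (s b) \<alpha> i, u i) \<in> lambar i)" by blast
    from bchoice[OF this] obtain u where u: "\<And>\<alpha>. \<alpha> \<in> Field r \<Longrightarrow> u \<alpha> \<in> Prod"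
      "\<And>\<alpha> b i. \<alpha> \<in> Field r \<Longrightarrow> b \<in> underS \<theta> a \<Longrightarrow> i \<in> K \<Longrightarrow> |underS \<theta> a| <o lambar i \<Longrightarrow>
        (k (s b) \<alpha> i, u \<alpha> i) \<in> lambar i"
      by blast
    obtain t where t: "(\<forall>\<alpha>\<in>Field r. t \<alpha> \<in> Prod \<and> (\<forall>i\<in>K. (u \<alpha> i, t \<alpha> i) \<in> lambar i)) \<and>
        (\<forall>\<alpha> \<beta>. (\<beta>, \<alpha>) \<in> r \<longrightarrow> le J (t \<beta>) (t \<alpha>))"
      using increasing_majorant[where u = u, OF r(1) J dir u(1)] by (rule exE)
    have "(k (s b) \<alpha> i, t \<alpha> i) \<in> lambar i"
      if "b \<in> underS \<theta> a" "\<alpha> \<in> Field r" "i \<in> K" "|underS \<theta> a| <o lambar i" for b \<alpha> i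
      using Well_order_trans[OF wo[OF that(3)] u(2)[OF that(2,1,3,4)]] t that(2,3) by blast
    moreover have "t \<in> S" using t unfolding S_def by simp
    ultimately show "\<exists>t\<in>S. \<forall>b\<in>underS \<theta> a. \<forall>\<alpha>\<in>Field r. \<forall>i\<in>K. |underS \<theta> a| <o lambar i \<longrightarrow>
        (k (s b) \<alpha> i, t \<alpha> i) \<in> lambar i" by blast
  qed
  then obtain s where s: "\<And>a. a \<in> Field \<theta> \<Longrightarrow> s a \<in> S"
    and stop: "\<And>\<alpha> c. \<alpha> \<in> Field r \<Longrightarrow> \<exists>a\<in>Field \<theta>.
      {i \<in> K. (c i, k (s a) \<alpha> i) \<in> lambar i \<and> (c i, s a \<alpha> i) \<notin> lambar i} \<in> I" by blast
  have "|(\<lambda>a. h (s a)) ` Field \<theta>| <o cardSuc \<theta>"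
    by (rule card_image_Field_ordLess[OF Card_order_\<theta> cardSuc_greater[OF Card_order_\<theta>]])
  moreover have "(\<lambda>a. h (s a)) ` Field \<theta> \<subseteq> Prod" using h s by auto
  ultimately obtain c where c: "c \<in> Prod" "\<And>a. a \<in> Field \<theta> \<Longrightarrow> le I (h (s a)) c"
    using directed_mod_I unfolding directed_card_def by (metis imageI)
  have "\<exists>\<alpha>. \<forall>a\<in>Field \<theta>. \<alpha> a \<in> Field r \<and> le (dual_ideal K (D (s a))) c (k (s a) (\<alpha> a))"
    using k(3)[OF s c(1)] by metis
  then obtain \<alpha> where \<alpha>: "\<And>a. a \<in> Field \<theta> \<Longrightarrow> \<alpha> a \<in> Field r"
    "\<And>a. a \<in> Field \<theta> \<Longrightarrow> le (dual_ideal K (D (s a))) c (k (s a) (\<alpha> a))" by blast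
  obtain \<beta> where \<beta>: "\<beta> \<in> Field r" "\<And>a. a \<in> Field \<theta> \<Longrightarrow> (\<alpha> a, \<beta>) \<in> r"
    using bound_choices_below_regular[OF r(1) regular_if_new_set[OF r(1) B], of \<alpha>] \<alpha>(1) by blast
  obtain a where a: "a \<in> Field \<theta>"
    and in_I: "{i \<in> K. (c i, k (s a) \<beta> i) \<in> lambar i \<and> (c i, s a \<beta> i) \<notin> lambar i} \<in> I"
    using stop[OF \<beta>(1), of c] by blast
  note Da = D[OF s[OF a]] and Ja = ideal_on_dual_ideal[OF D(1)[OF s[OF a]]]
  have "le (dual_ideal K (D (s a))) (k (s a) (\<alpha> a)) (k (s a) \<beta>)"
    using le_refl[OF Ja k(1)[OF s[OF a] \<beta>(1)]] lt_imp_le[OF Ja k(2)[OF s[OF a] \<beta>(2)[OF a]]]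
    by (cases "\<alpha> a = \<beta>") simp_all
  then have "le (dual_ideal K (D (s a))) c (k (s a) \<beta>)" by (rule le_trans[OF Ja \<alpha>(2)[OF a]])
  then have 1: "{i \<in> K. (c i, k (s a) \<beta> i) \<in> lambar i} \<in> D (s a)" using le_dual_iff[OF Da(1)] by simp
  have "le (dual_ideal K (D (s a))) (h (s a)) c"
    by (rule le_mono[OF ideal_subset_dual_ideal[OF Da(1) ideal_I Da(2)] c(2)[OF a]])
  then have 2: "{i \<in> K. (h (s a) i, c i) \<in> lambar i} \<in> D (s a)" using le_dual_iff[OF Da(1)] by simp
  have "{i \<in> K. (c i, k (s a) \<beta> i) \<in> lambar i \<and> (c i, s a \<beta> i) \<notin> lambar i} \<notin> I"
    by (rule ultrafilter_Int_not_in_ideal[OF Da hD[OF s[OF a] \<beta>(1)] ultrafilter_on_Int[OF Da(1) 1 2]])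
      (use Well_order_trans[OF wo] in blast)+
  then show False using in_I by contradiction
qed

text \<open>
  Directedness and the cofinal sequence are available over \<open>K\<close>; functions on \<open>B\<close> are extended to \<open>K\<close>
  arbitrarily and restricted back. Over \<open>B\<close> the relations modulo \<open>J\<close> are those modulo the ideal
  \<open>J \<inter> Pow B\<close>, so that the product over \<open>B\<close> is an instance of the same theory. Minimality holds
  since the strict relation is irreflexive, which is where \<open>B \<notin> J\<close> enters.
\<close>

theorem true_cofinality_on_new_set:
  assumes r: "Card_order r" "infinite (Field r)"
    and B: "B \<in> J_leq K I lambar r - J_less K I lambar r"
  shows "is_least_card (has_true_cofinality (card_prod B lambar)
      (le_mod B lambar (J_less K I lambar r)) (less_mod B lambar (J_less K I lambar r))) r"
proof -
  define J where "J = J_less K I lambar r"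
  have J: "ideal_on K J" unfolding J_def by (rule ideal_J_less)
  have BK: "B \<subseteq> K" using B J_less_subset unfolding J_leq_def by blast
  interpret B: regular_product B lambar by unfold_locales (use regular BK in blast)
  define JB where "JB = J \<inter> Pow B"
  have JB: "ideal_on B JB"
    using ideal_on_subset[OF J] ideal_on_Un[OF J] J unfolding JB_def
    by (auto simp: ideal_on_def)
  have eq: "le_mod B lambar J = B.le JB" "less_mod B lambar J = B.lt JB"
    by (auto simp: fun_eq_iff le_mod_def less_mod_def JB_def)
  have irr: "\<not> B.le JB y x" if "B.lt JB x y" for x y
  proof
    assume "B.le JB y x"
    then have "B.lt JB x x" by (rule B.lt_le_trans[OF JB that])
    then have "B \<in> J" by (simp add: less_mod_def JB_def)
    then show False using B by (simp add: J_def)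
  qed
  have restrict: "restrict u B \<in> card_prod B lambar" if "u \<in> Prod" for u
    using that BK by (auto simp: card_prod_def)
  have extend: "\<exists>u\<in>Prod. \<forall>i\<in>B. u i = q i" if "q \<in> card_prod B lambar" for q
  proof -
    have "\<exists>u\<in>Prod. \<forall>i\<in>K. i \<in> B \<longrightarrow> u i = q i"
    proof (rule pointwise_choice)
      fix i assume "i \<in> K"
      then have "Field (lambar i) \<noteq> {}" using regular by force
      then show "\<exists>x\<in>Field (lambar i). i \<in> B \<longrightarrow> x = q i"
        using B.prod_Field[OF that, of i] by (cases "i \<in> B") auto
    qed
    then show ?thesis using BK by blast
  qed
  then obtain e where e: "\<And>q. q \<in> card_prod B lambar \<Longrightarrow> e q \<in> Prod"
    "\<And>q i. q \<in> card_prod B lambar \<Longrightarrow> i \<in> B \<Longrightarrow> e q i = q i" by metis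
  have "directed_card (card_prod B lambar) (B.le JB) r" unfolding directed_card_def
  proof (intro allI impI)
    fix A assume A: "A \<subseteq> card_prod B lambar \<and> |A| <o r"
    then have "|e ` A| <o r" "e ` A \<subseteq> Prod" using card_image_ordLess[of A r e] e(1) by auto
    then obtain u where u: "u \<in> Prod" "\<And>q. q \<in> A \<Longrightarrow> le J (e q) u"
      using directed_mod_J_less[OF r(1)] unfolding directed_card_def J_def by (metis imageI)
    have "B.le JB q (restrict u B)" if "q \<in> A" for q
    proof -
      have "{i \<in> B. (q i, restrict u B i) \<notin> lambar i} \<in> J"
        using e(2)[of q] A that BK
        by (intro ideal_on_subset[OF J u(2)[OF that, unfolded le_mod_def]]) auto
      then show ?thesis by (auto simp: le_mod_def JB_def)
    qed
    then show "\<exists>u\<in>card_prod B lambar. \<forall>a\<in>A. B.le JB a u" using restrict[OF u(1)] by blast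
  qed
  then have dir: "directed_card (card_prod B lambar) (B.lt JB) r"
    by (rule B.directed_lt_if_directed_le[OF JB])
  obtain f where f: "\<And>\<alpha>. \<alpha> \<in> Field r \<Longrightarrow> f \<alpha> \<in> Prod"
    "\<And>q. q \<in> Prod \<Longrightarrow> \<exists>\<alpha>\<in>Field r. {i \<in> B. (q i, f \<alpha> i) \<notin> lambar i} \<in> J"
    using cofinal_sequence_on_new_set[OF r B] unfolding J_def by blast
  have "has_true_cofinality (card_prod B lambar) (B.le JB) (B.lt JB) r"
  proof (rule true_cofinality_if_directed[OF r dir, of "\<lambda>\<alpha>. restrict (f \<alpha>) B"])
    fix q assume q: "q \<in> card_prod B lambar"
    obtain \<alpha> where \<alpha>: "\<alpha> \<in> Field r" "{i \<in> B. (e q i, f \<alpha> i) \<notin> lambar i} \<in> J"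
      using f(2)[OF e(1)[OF q]] by blast
    have "{i \<in> B. (q i, restrict (f \<alpha>) B i) \<notin> lambar i} = {i \<in> B. (e q i, f \<alpha> i) \<notin> lambar i}"
      using e(2)[OF q] by auto
    then have "B.le JB q (restrict (f \<alpha>) B)" using \<alpha>(2) by (auto simp: le_mod_def JB_def)
    then show "\<exists>\<alpha>\<in>Field r. B.le JB q (restrict (f \<alpha>) B)" using \<alpha>(1) by blast
  qed (use restrict f(1) B.le_trans[OF JB] B.lt_imp_le[OF JB] in blast)+
  moreover have "r \<le>o s"
    if "Card_order s" "has_true_cofinality (card_prod B lambar) (B.le JB) (B.lt JB) s" for s :: "'c rel"
    using directed_le_true_cofinality[OF r(1) that dir] irr by blast
  ultimately show ?thesis using r(1) unfolding is_least_card_def J_def[symmetric] eq by blast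
qed

text \<open>
  For each \<open>\<gamma>\<close> with \<open>A \<gamma> \<notin> J\<close> there is a sequence \<open>c \<gamma>\<close> cofinal on \<open>A \<gamma>\<close>; as there are fewer than \<open>r\<close> of
  them, one \<open>J\<close>-increasing sequence \<open>f\<close> dominates them all. Given \<open>g\<close>, every \<open>c \<gamma>\<close> exceeds \<open>g\<close> on almost
  all of \<open>A \<gamma>\<close> from some index on, and regularity of \<open>r\<close> makes one index \<open>\<alpha>\<close> serve all \<open>\<gamma>\<close>. So
  \<open>B = {i. g i < f \<alpha> i}\<close> is an upper bound of the sets \<open>A \<gamma>\<close>, and if it never lies in \<open>J_leq\<close>, there is
  always an ultrafilter containing it whose true cofinality exceeds \<open>r\<close>; this yields a perpetual
  climb.
\<close>

theorem J_leq_directed_mod_J_less: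
  assumes r: "Card_order r" "infinite (Field r)" and \<Gamma>: "|\<Gamma>| <o r"
    and A: "\<And>\<gamma>. \<gamma> \<in> \<Gamma> \<Longrightarrow> A \<gamma> \<in> J_leq K I lambar r"
  shows "\<exists>B\<in>J_leq K I lambar r. \<forall>\<gamma>\<in>\<Gamma>. A \<gamma> - B \<in> J_less K I lambar r"
proof (rule ccontr)
  assume no_bound: "\<not> ?thesis"
  define J where "J = J_less K I lambar r"
  have J: "ideal_on K J" unfolding J_def by (rule ideal_J_less)
  have dir: "directed_card Prod (le J) r" unfolding J_def by (rule directed_mod_J_less[OF r(1)])
  define G where "G = {\<gamma> \<in> \<Gamma>. A \<gamma> \<notin> J}"
  have AK: "A \<gamma> \<subseteq> K" if "\<gamma> \<in> \<Gamma>" for \<gamma>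
    using J_less_subset[OF A[OF that, unfolded J_leq_def]] .
  have fails: "B \<notin> J_leq K I lambar r" if "\<And>\<gamma>. \<gamma> \<in> G \<Longrightarrow> A \<gamma> - B \<in> J" for B
  proof
    assume B: "B \<in> J_leq K I lambar r"
    have "A \<gamma> - B \<in> J" if "\<gamma> \<in> \<Gamma>" for \<gamma>
      using \<open>\<And>\<gamma>. \<gamma> \<in> G \<Longrightarrow> A \<gamma> - B \<in> J\<close>[of \<gamma>] ideal_on_subset[OF J, of "A \<gamma>" "A \<gamma> - B"] that
      unfolding G_def by blast
    then show False using no_bound B unfolding J_def by blast
  qed
  have new: "A \<gamma> \<in> J_leq K I lambar r - J_less K I lambar r" if "\<gamma> \<in> G" for \<gamma>
    using A that by (auto simp: G_def J_def)
  have "{} \<in> J_leq K I lambar r" using ideal_J_less unfolding J_leq_def ideal_on_def by blast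
  then obtain \<gamma>0 where "\<gamma>0 \<in> G" using fails[of "{}"] by blast
  note reg = regular_if_new_set[OF r(1) new[OF this]]
  have G: "|G| <o r"
    using ordLeq_ordLess_trans[OF card_of_mono1 \<Gamma>, of G] by (simp add: G_def)
  define scale where "scale \<gamma> f \<longleftrightarrow> (\<forall>\<alpha>\<in>Field r. f \<alpha> \<in> Prod) \<and>
    (\<forall>\<alpha> \<beta>. (\<alpha>, \<beta>) \<in> r \<longrightarrow> le J (f \<alpha>) (f \<beta>)) \<and>
    (\<forall>q\<in>Prod. \<exists>\<alpha>\<in>Field r. {i \<in> A \<gamma>. (q i, f \<alpha> i) \<notin> lambar i} \<in> J)" for \<gamma> f
  have "\<forall>\<gamma>\<in>G. \<exists>f. scale \<gamma> f"
    unfolding scale_def J_def using cofinal_sequence_on_new_set[OF r new] by blast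
  then obtain c where c: "\<forall>\<gamma>\<in>G. scale \<gamma> (c \<gamma>)" by (rule bchoice[THEN exE])
  have "\<exists>u\<in>Prod. \<forall>\<gamma>\<in>G. le J (c \<gamma> \<alpha>) u" if \<alpha>: "\<alpha> \<in> Field r" for \<alpha>
  proof -
    have "(\<lambda>\<gamma>. c \<gamma> \<alpha>) ` G \<subseteq> Prod" using c \<alpha> unfolding scale_def by auto
    moreover have "|(\<lambda>\<gamma>. c \<gamma> \<alpha>) ` G| <o r" by (rule card_image_ordLess[OF G])
    ultimately show ?thesis using dir unfolding directed_card_def by (metis imageI)
  qed
  then obtain u where u: "\<And>\<alpha>. \<alpha> \<in> Field r \<Longrightarrow> u \<alpha> \<in> Prod"
    "\<And>\<alpha> \<gamma>. \<alpha> \<in> Field r \<Longrightarrow> \<gamma> \<in> G \<Longrightarrow> le J (c \<gamma> \<alpha>) (u \<alpha>)" by metis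
  obtain f where f': "(\<forall>\<alpha>\<in>Field r. f \<alpha> \<in> Prod \<and> (\<forall>i\<in>K. (u \<alpha> i, f \<alpha> i) \<in> lambar i)) \<and>
      (\<forall>\<alpha> \<beta>. (\<beta>, \<alpha>) \<in> r \<longrightarrow> le J (f \<beta>) (f \<alpha>))"
    using increasing_majorant[where u = u, OF r(1) J dir u(1)] by (rule exE)
  have f: "\<And>\<alpha>. \<alpha> \<in> Field r \<Longrightarrow> f \<alpha> \<in> Prod" "\<And>\<alpha> \<beta>. (\<beta>, \<alpha>) \<in> r \<Longrightarrow> le J (f \<beta>) (f \<alpha>)"
    using f' by blast+
  have c_le_f: "le J (c \<gamma> \<alpha>) (f \<alpha>)" if "\<alpha> \<in> Field r" "\<gamma> \<in> G" for \<alpha> \<gamma>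
    using f' that(1) by (intro le_trans[OF J u(2)[OF that]] le_if_pointwise[OF J]) blast
  show False
  proof (rule no_perpetual_climb[OF r(1) reg])
    fix g assume g: "g \<in> Prod"
    \<comment> \<open>Passing to the successor of \<open>g\<close> makes the weak cofinality of \<open>c \<gamma>\<close> give strict inequality.\<close>
    obtain g' where g': "g' \<in> Prod" "\<forall>i\<in>K. (g i, g' i) \<in> lambar i \<and> g i \<noteq> g' i"
      using pointwise_successor[OF g] by blast
    have "\<forall>\<gamma>\<in>G. \<exists>\<alpha>. \<alpha> \<in> Field r \<and> {i \<in> A \<gamma>. (g' i, c \<gamma> \<alpha> i) \<notin> lambar i} \<in> J"
      using c g'(1) unfolding scale_def by blast
    then obtain a where a: "\<forall>\<gamma>\<in>G. a \<gamma> \<in> Field r \<and> {i \<in> A \<gamma>. (g' i, c \<gamma> (a \<gamma>) i) \<notin> lambar i} \<in> J"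
      by (rule bchoice[THEN exE])
    have "a ` G \<subseteq> Field r" using a by blast
    then obtain \<alpha> where \<alpha>: "\<alpha> \<in> Field r" "\<forall>x\<in>a ` G. (x, \<alpha>) \<in> r"
      using regular_bounded[OF r(1) reg(1) _ card_image_ordLess[OF G]] by blast
    define B where "B = {i \<in> K. (f \<alpha> i, g i) \<notin> lambar i}"
    have "A \<gamma> - B \<in> J" if \<gamma>: "\<gamma> \<in> G" for \<gamma>
    proof -
      have "(a \<gamma>, \<alpha>) \<in> r" using \<alpha>(2) \<gamma> by blast
      then have "le J (c \<gamma> (a \<gamma>)) (c \<gamma> \<alpha>)" using c \<gamma> unfolding scale_def by blast
      then have "le J (c \<gamma> (a \<gamma>)) (f \<alpha>)" by (rule le_trans[OF J _ c_le_f[OF \<alpha>(1) \<gamma>]])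
      then have 1: "{i \<in> K. (c \<gamma> (a \<gamma>) i, f \<alpha> i) \<notin> lambar i} \<in> J" by (simp add: le_mod_def)
      have 2: "{i \<in> A \<gamma>. (g' i, c \<gamma> (a \<gamma>) i) \<notin> lambar i} \<in> J" using a \<gamma> by blast
      show ?thesis
      proof (rule ideal_on_subset_Un[OF J 1 2], rule subsetI, rule ccontr)
        fix i assume i: "i \<in> A \<gamma> - B" and "i \<notin> {i \<in> K. (c \<gamma> (a \<gamma>) i, f \<alpha> i) \<notin> lambar i} \<union>
          {i \<in> A \<gamma>. (g' i, c \<gamma> (a \<gamma>) i) \<notin> lambar i}"
        moreover have iK: "i \<in> K" using i AK \<gamma> by (auto simp: G_def)
        ultimately have "(g' i, c \<gamma> (a \<gamma>) i) \<in> lambar i" "(c \<gamma> (a \<gamma>) i, f \<alpha> i) \<in> lambar i"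
          "(f \<alpha> i, g i) \<in> lambar i" by (auto simp: B_def)
        then have "(g' i, g i) \<in> lambar i" using Well_order_trans[OF wo[OF iK]] by blast
        then show False using g'(2) iK Well_order_antisym[OF wo[OF iK]] by blast
      qed
    qed
    then have "B \<notin> J_less K I lambar (cardSuc r)" using fails unfolding J_leq_def by blast
    moreover have "B \<subseteq> K" by (auto simp: B_def)
    ultimately obtain D where D: "ultrafilter_on K D" "D \<inter> I = {}" "B \<in> D"
      and tcf: "cardSuc r \<le>o tcf_ultraprod K lambar D"
      by (elim not_in_J_lessE)
    have r_tcf: "r <o tcf_ultraprod K lambar D"
      by (rule ordLess_ordLeq_trans[OF cardSuc_greater[OF r(1)] tcf])
    then have "D \<inter> J = {}"
      using disjoint_J_less_iff[OF D(1,2) r(1)] ordLess_imp_ordLeq unfolding J_def by blast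
    then have JD: "J \<subseteq> dual_ideal K D" by (rule ideal_subset_dual_ideal[OF D(1) J])
    have "|f ` Field r| <o tcf_ultraprod K lambar D"
      by (rule card_image_Field_ordLess[OF r(1) r_tcf])
    from climb_mod_ultrafilter[where f = f and g = g and \<alpha> = \<alpha>, OF D(1,2) JD f(1) this f(2) D(3)[unfolded B_def]]
    show "\<exists>h\<in>Prod. \<exists>\<alpha>\<in>Field r. \<forall>\<beta>. (\<alpha>, \<beta>) \<in> r \<longrightarrow>
        {i \<in> K. (f \<beta> i, h i) \<in> lambar i \<and> (f \<beta> i, g i) \<notin> lambar i} \<notin> I"
      using \<alpha>(1) by blast
  qed
qed

text \<open>
  If \<open>D\<close> met no set of \<open>J_leq\<close> at the cofinality \<open>c\<close> of its ultraproduct, directedness modulo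
  \<open>J_leq\<close>, which is \<open>J_less\<close> at \<open>c\<^sup>+\<close>, would carry over to \<open>D\<close> and force the cofinality above \<open>c\<close>.
\<close>

theorem cf_ultraprod_least:
  assumes D: "ultrafilter_on K D" "D \<inter> I = {}"
  shows "is_least_card (\<lambda>\<mu> :: ('k \<Rightarrow> 'a) rel. infinite (Field \<mu>) \<and> D \<inter> J_leq K I lambar \<mu> \<noteq> {})
    (cf_ultraprod K lambar D)"
proof -
  let ?c = "cf_ultraprod K lambar D" and ?t = "tcf_ultraprod K lambar D"
  have tc: "?t =o ?c" by (rule tcf_ordIso_cf_ultraprod[OF D(1)])
  have c: "Card_order ?c" by (rule Card_order_ordIso2[OF Card_order_tcf_ultraprod[OF D(1)] tc])
  have "infinite (Field ?c)"
    using infinite_tcf_ultraprod[OF D(1)] card_of_ordIso_finite[OF card_of_cong[OF tc]] by simp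
  moreover have "\<not> ?c <o ?t" using tc not_ordLess_ordIso ordIso_symmetric by metis
  then have "D \<inter> J_leq K I lambar ?c \<noteq> {}" using disjoint_J_leq_iff[OF D c] by simp
  moreover have "?c \<le>o s" if s: "Card_order s" "D \<inter> J_leq K I lambar s \<noteq> {}"
    for s :: "('k \<Rightarrow> 'a) rel"
  proof -
    have "\<not> s <o ?t" using disjoint_J_leq_iff[OF D s(1)] s(2) by simp
    then have "?t \<le>o s"
      using not_ordLeq_imp_ordLess[OF Card_order_tcf_ultraprod[OF D(1)] s(1)] by blast
    then show ?thesis by (rule ordIso_ordLeq_trans[OF ordIso_symmetric[OF tc]])
  qed
  ultimately show ?thesis using c by (auto simp: is_least_card_def)
qed

text \<open>
  The union is an ideal. A set \<open>B\<close> outside it lies in an ultrafilter \<open>D\<close> missing the whole union, so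
  the true cofinality of \<open>D\<close> exceeds every cardinal \<open>\<mu> <o r\<close> and cannot itself be one of them; thus
  \<open>D\<close> witnesses \<open>B \<notin> J_less\<close>.
\<close>

theorem J_less_eq_Union_J_leq:
  fixes r :: "'c rel"
  assumes r: "Card_order r" "infinite (Field r)"
  shows "J_less K I lambar r = (\<Union>\<mu> \<in> {\<mu> :: 'c rel. Card_order \<mu> \<and> \<mu> <o r}. J_leq K I lambar \<mu>)"
    (is "_ = ?U")
proof
  show "?U \<subseteq> J_less K I lambar r"
    using J_less_mono cardSuc_least[OF _ r(1)] unfolding J_leq_def by blast
  \<comment> \<open>The cardinal \<open>0\<close> serves as a member of the index set, which has to be nonempty.\<close>
  have bot: "|{} :: 'c set| <o r"
  proof (rule not_ordLeq_imp_ordLess[OF r(1) card_of_Card_order])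
    show "\<not> r \<le>o |{} :: 'c set|"
    proof
      assume "r \<le>o |{} :: 'c set|"
      then have "|Field r| \<le>o |{} :: 'c set|"
        using card_of_mono2[of r "|{} :: 'c set|"] by (simp only: Field_card_of)
      then show False using r(2) card_of_ordLeq_finite by blast
    qed
  qed
  have U: "ideal_on K ?U" unfolding ideal_on_def
  proof (intro conjI ballI allI impI)
    show "?U \<subseteq> Pow K" using J_less_subset unfolding J_leq_def by blast
    have "{} \<in> J_leq K I lambar |{} :: 'c set|"
      using ideal_J_less unfolding J_leq_def ideal_on_def by blast
    then show "{} \<in> ?U" using bot card_of_Card_order by blast
  next
    fix X Y assume "X \<in> ?U" and YX: "Y \<subseteq> X"
    then obtain \<mu> :: "'c rel" where \<mu>: "Card_order \<mu>" "\<mu> <o r" "X \<in> J_leq K I lambar \<mu>" by blast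
    then have "Y \<in> J_leq K I lambar \<mu>"
      using ideal_on_subset[OF ideal_J_less _ YX] unfolding J_leq_def by blast
    then show "Y \<in> ?U" using \<mu> by blast
  next
    fix X Y assume "X \<in> ?U" "Y \<in> ?U"
    then obtain \<mu> \<nu> :: "'c rel" where \<mu>: "Card_order \<mu>" "\<mu> <o r" "X \<in> J_leq K I lambar \<mu>"
      and \<nu>: "Card_order \<nu>" "\<nu> <o r" "Y \<in> J_leq K I lambar \<nu>" by blast
    have *: "J_leq K I lambar s \<subseteq> J_leq K I lambar t"
      if "Card_order s" "Card_order t" "s \<le>o t" for s t :: "'c rel"
      using J_less_mono cardSuc_mono_ordLeq[OF that(1,2)] that(3) unfolding J_leq_def by blast
    have "\<mu> \<le>o \<nu> \<or> \<nu> \<le>o \<mu>"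
      using not_ordLeq_imp_ordLess[OF \<mu>(1) \<nu>(1)] ordLess_imp_ordLeq by blast
    then obtain \<rho> :: "'c rel" where \<rho>: "Card_order \<rho>" "\<rho> <o r" "X \<in> J_leq K I lambar \<rho>"
      "Y \<in> J_leq K I lambar \<rho>"
      using *[OF \<mu>(1) \<nu>(1)] *[OF \<nu>(1) \<mu>(1)] \<mu> \<nu> by blast
    then have "X \<union> Y \<in> J_leq K I lambar \<rho>"
      using ideal_on_Un[OF ideal_J_less] unfolding J_leq_def by blast
    then show "X \<union> Y \<in> ?U" using \<rho> by blast
  qed
  have I_U: "I \<subseteq> ?U"
    using I_subset_J_less bot card_of_Card_order unfolding J_leq_def by blast
  show "J_less K I lambar r \<subseteq> ?U"
  proof (rule subsetI, rule ccontr)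
    fix B assume B: "B \<in> J_less K I lambar r" and BU: "B \<notin> ?U"
    obtain D where D: "ultrafilter_on K D" "B \<in> D" and DU: "D \<inter> ?U = {}"
      using ultrafilter_avoiding_ideal[OF U J_less_subset[OF B] BU] by blast
    have DI: "D \<inter> I = {}" using DU I_U by blast
    let ?t = "tcf_ultraprod K lambar D"
    have t: "Card_order ?t" by (rule Card_order_tcf_ultraprod[OF D(1)])
    have tr: "?t <o r"
      by (rule not_ordLeq_imp_ordLess[OF r(1) t J_lessD[OF B D(1) DI D(2)]])
    then obtain \<mu> :: "'c rel" where \<mu>: "Card_order \<mu>" "\<mu> =o ?t"
      using cardinal_copy[OF t r(1) ordLess_imp_ordLeq] by blast
    have "J_leq K I lambar \<mu> \<subseteq> ?U" using \<mu>(1) ordIso_ordLess_trans[OF \<mu>(2) tr] by blast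
    then have "D \<inter> J_leq K I lambar \<mu> = {}" using DU by blast
    then have "\<mu> <o ?t" using disjoint_J_leq_iff[OF D(1) DI \<mu>(1)] by simp
    then show False using \<mu>(2) not_ordLess_ordIso by blast
  qed
qed

theorem J_less_limit:
  fixes r :: "'c rel"
  assumes "limit_card r"
  shows "J_less K I lambar r = (\<Union>\<mu> \<in> {\<mu> :: 'c rel. Card_order \<mu> \<and> \<mu> <o r}. J_less K I lambar \<mu>)"
    (is "_ = ?U")
proof
  have r: "Card_order r" "infinite (Field r)"
    and limit: "\<And>s :: 'c rel. Card_order s \<Longrightarrow> s <o r \<Longrightarrow> cardSuc s <o r"
    using assms by (auto simp: limit_card_def)
  show "?U \<subseteq> J_less K I lambar r" using J_less_mono ordLess_imp_ordLeq by blast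
  show "J_less K I lambar r \<subseteq> ?U"
  proof
    fix B assume "B \<in> J_less K I lambar r"
    then obtain \<mu> :: "'c rel" where \<mu>: "Card_order \<mu>" "\<mu> <o r" "B \<in> J_less K I lambar (cardSuc \<mu>)"
      unfolding J_less_eq_Union_J_leq[OF r] J_leq_def by blast
    note suc = limit[OF \<mu>(1,2)]
    obtain \<nu> :: "'c rel" where \<nu>: "Card_order \<nu>" "\<nu> =o cardSuc \<mu>"
      using cardinal_copy[OF cardSuc_Card_order[OF \<mu>(1)] r(1) ordLess_imp_ordLeq[OF suc]] by blast
    have "B \<in> J_less K I lambar \<nu>"
      using J_less_mono[OF ordIso_imp_ordLeq[OF ordIso_symmetric[OF \<nu>(2)]]] \<mu>(3) by blast
    then show "B \<in> ?U" using \<nu>(1) ordIso_ordLess_trans[OF \<nu>(2) suc] by blast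
  qed
qed

lemma J_less_subset_J_leq: "Card_order r \<Longrightarrow> J_less K I lambar r \<subseteq> J_leq K I lambar r"
  unfolding J_leq_def by (rule J_less_mono[OF cardSuc_ordLeq])

text \<open>
  A set in the difference lies in an ultrafilter of true cofinality at least, hence exactly, \<open>r\<close>.
  Conversely an ultrafilter of true cofinality \<open>r\<close> misses \<open>J_less\<close> and meets \<open>J_leq\<close>.
\<close>

theorem new_set_iff_in_pcf:
  assumes r: "Card_order r"
  shows "J_leq K I lambar r - J_less K I lambar r \<noteq> {} \<longleftrightarrow> r \<in> pcf K I lambar"
proof
  assume "J_leq K I lambar r - J_less K I lambar r \<noteq> {}"
  then obtain B where B: "B \<in> J_leq K I lambar r" "B \<notin> J_less K I lambar r" by blast
  have "B \<subseteq> K" using B J_less_subset unfolding J_leq_def by blast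
  then obtain D where D: "ultrafilter_on K D" "D \<inter> I = {}" "B \<in> D"
    "r \<le>o tcf_ultraprod K lambar D"
    using B(2) by (elim not_in_J_lessE)
  then have "tcf_ultraprod K lambar D =o r"
    using tcf_ordIso_if_in_J_leq[OF D(1,2) r _ D(3) B(1)] disjoint_J_less_iff[OF D(1,2) r] by blast
  then show "r \<in> pcf K I lambar" using r D by (auto simp: pcf_def)
next
  assume "r \<in> pcf K I lambar"
  then obtain D where D: "ultrafilter_on K D" "D \<inter> I = {}" and tcf: "tcf_ultraprod K lambar D =o r"
    by (auto simp: pcf_def)
  have "\<not> r <o tcf_ultraprod K lambar D"
    using not_ordLess_ordIso ordIso_symmetric[OF tcf] by blast
  then obtain B where B: "B \<in> D" "B \<in> J_leq K I lambar r" using disjoint_J_leq_iff[OF D r] by blast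
  have "D \<inter> J_less K I lambar r = {}"
    using disjoint_J_less_iff[OF D r] ordIso_imp_ordLeq[OF ordIso_symmetric[OF tcf]] by simp
  then show "J_leq K I lambar r - J_less K I lambar r \<noteq> {}" using B by blast
qed

end

section \<open>Saturation and the limit inferior\<close>

text \<open>
  The least cardinal exists because a partition of \<open>K\<close> has at most \<open>|K|\<close> parts.
\<close>

lemma is_least_card_wsat:
  "is_least_card (\<lambda>r. Field r \<noteq> {} \<and>
     \<not> (\<exists>P. partition_on K P \<and> P \<subseteq> positive_sets K J \<and> |P| =o r)) (wsat K J)"
  unfolding wsat_def
proof (rule is_least_card_least_card[of "cardSuc |K|"])
  show "Card_order (cardSuc |K| )" by (rule cardSuc_Card_order[OF card_of_Card_order])
  have "\<not> |P| =o cardSuc |K|" if P: "partition_on K P" for P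
  proof
    assume eq: "|P| =o cardSuc |K|"
    have "\<forall>p\<in>P. \<exists>x. x \<in> p" using P unfolding partition_on_def by (metis ex_in_conv)
    then obtain x where x: "\<forall>p\<in>P. x p \<in> p" by (rule bchoice[THEN exE])
    have "inj_on x P"
    proof (rule inj_onI)
      fix p q assume "p \<in> P" "q \<in> P" "x p = x q"
      then have "x p \<in> p \<inter> q" using x by auto
      then show "p = q"
        using P \<open>p \<in> P\<close> \<open>q \<in> P\<close> disjointD[of P p q] by (auto simp: partition_on_def)
    qed
    moreover have "x p \<in> K" if "p \<in> P" for p using x P that by (auto simp: partition_on_def)
    ultimately have "|P| \<le>o |K|" by (rule card_of_ordLeqI)
    then have "cardSuc |K| \<le>o |K|" by (rule ordIso_ordLeq_trans[OF ordIso_symmetric[OF eq]])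
    then show False
      using cardSuc_greater[OF card_of_Card_order[of K]] not_ordLess_ordLeq by blast
  qed
  then show "Field (cardSuc |K| ) \<noteq> {} \<and>
      \<not> (\<exists>P. partition_on K P \<and> P \<subseteq> positive_sets K J \<and> |P| =o cardSuc |K| )"
    using Field_cardSuc_not_empty[OF card_of_Card_order] by blast
qed

text \<open>
  The definition of \<open>wsat\<close> speaks of partitions into exactly \<open>wsat\<close> many sets. A disjoint family
  of size \<open>\<theta>\<close> is thinned out to that size, and the rest of \<open>K\<close> is added to one of its members.
\<close>

lemma wsat_no_disjoint_family:
  assumes J: "ideal_on K J" and w: "wsat K J \<le>o \<theta>"
    and A: "\<And>a. a \<in> Field \<theta> \<Longrightarrow> A a \<subseteq> K \<and> A a \<notin> J"
    and disj: "\<And>a b. a \<in> Field \<theta> \<Longrightarrow> b \<in> Field \<theta> \<Longrightarrow> a \<noteq> b \<Longrightarrow> A a \<inter> A b = {}"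
  shows False
proof -
  define W where "W = Field (wsat K J)"
  have co: "Card_order (wsat K J)" and "W \<noteq> {}"
    and none: "\<And>P. partition_on K P \<Longrightarrow> P \<subseteq> positive_sets K J \<Longrightarrow> \<not> |P| =o wsat K J"
    using is_least_card_wsat[of K J] unfolding is_least_card_def W_def by blast+
  then obtain a0 where a0: "a0 \<in> W" by blast
  have "|W| \<le>o |Field \<theta>|" unfolding W_def by (rule card_of_mono2[OF w])
  then obtain e where e: "inj_on e W" "e ` W \<subseteq> Field \<theta>"
    unfolding card_of_ordLeq[symmetric] by blast
  have A_e: "A (e a) \<subseteq> K" "A (e a) \<notin> J" if "a \<in> W" for a using A e(2) that by blast+
  have disj_e: "A (e a) \<inter> A (e b) = {}" if "a \<in> W" "b \<in> W" "a \<noteq> b" for a b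
    using disj[of "e a" "e b"] e that by (auto simp: inj_on_def)
  define B where "B a = (if a = a0 then A (e a0) \<union> (K - (\<Union>b\<in>W. A (e b))) else A (e a))" for a
  have A_sub_B: "A (e a) \<subseteq> B a" for a by (auto simp: B_def)
  have B_K: "B a \<subseteq> K" if "a \<in> W" for a using A_e(1) that a0 by (auto simp: B_def)
  have B_pos: "B a \<notin> J" if "a \<in> W" for a
    using ideal_on_subset[OF J _ A_sub_B[of a]] A_e(2)[OF that] by blast
  have B_ne: "B a \<noteq> {}" if "a \<in> W" for a using B_pos[OF that] J by (auto simp: ideal_on_def)
  have B_disj: "B a \<inter> B b = {}" if "a \<in> W" "b \<in> W" "a \<noteq> b" for a b
    using disj_e[OF that] that by (auto simp: B_def)
  have inj: "inj_on B W"
  proof (rule inj_onI, rule ccontr)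
    fix a b assume "a \<in> W" "b \<in> W" "B a = B b" "a \<noteq> b"
    then show False using B_disj[of a b] B_ne[of a] by simp
  qed
  have "partition_on K (B ` W)" unfolding partition_on_def
  proof (intro conjI)
    show "\<Union> (B ` W) = K"
    proof
      show "\<Union> (B ` W) \<subseteq> K" using B_K by blast
      show "K \<subseteq> \<Union> (B ` W)"
      proof
        fix i assume "i \<in> K"
        then have "i \<in> B a0 \<or> (\<exists>b\<in>W. i \<in> A (e b))" by (auto simp: B_def)
        then show "i \<in> \<Union> (B ` W)" using a0 A_sub_B by blast
      qed
    qed
    show "disjoint (B ` W)" using B_disj by (auto simp: disjoint_def)
    show "{} \<notin> B ` W" using B_ne by blast
  qed
  moreover have "B ` W \<subseteq> positive_sets K J" using B_K B_pos by (auto simp: positive_sets_def)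
  moreover have "|B ` W| =o wsat K J"
  proof (rule ordIso_transitive[OF ordIso_symmetric])
    show "|W| =o |B ` W|" using inj by (intro card_of_ordIsoI) (rule inj_on_imp_bij_betw)
    show "|W| =o wsat K J" unfolding W_def by (rule card_of_Field_ordIso[OF co])
  qed
  ultimately show False using none by blast
qed

text \<open>
  The cardinal \<open>\<mu>\<close> lives on another type than \<open>liminf_card\<close>, whose minimality is applied to a copy of
  \<open>\<mu>\<close>; the cardinal of the whole type of the factors shows that the minimum exists.
\<close>

lemma small_factors_in_ideal:
  fixes lambar :: "'k \<Rightarrow> 'a rel"
  assumes J: "proper_ideal_on K J" and lambar: "\<And>i. i \<in> K \<Longrightarrow> Card_order (lambar i)"
    and \<theta>: "\<theta> \<le>o liminf_card K J lambar" and \<mu>: "Card_order \<mu>" "\<mu> <o \<theta>"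
  shows "{i \<in> K. lambar i \<le>o \<mu>} \<in> J"
proof (rule ccontr)
  assume pos: "{i \<in> K. lambar i \<le>o \<mu>} \<notin> J"
  let ?Q = "\<lambda>r :: 'a rel. {i \<in> K. lambar i \<le>o r} \<in> positive_sets K J"
  have "lambar i \<le>o |UNIV :: 'a set|" if "i \<in> K" for i
    using ordIso_ordLeq_trans[OF ordIso_symmetric[OF card_of_Field_ordIso[OF lambar[OF that]]]
        card_of_mono1[OF subset_UNIV]] .
  then have "{i \<in> K. lambar i \<le>o |UNIV :: 'a set| } = K" by blast
  then have "?Q |UNIV :: 'a set|"
    using J by (simp add: positive_sets_def proper_ideal_on_def)
  then have least: "is_least_card ?Q (liminf_card K J lambar)"
    unfolding liminf_card_def by (rule is_least_card_least_card[OF card_of_Card_order])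
  have less: "\<mu> <o liminf_card K J lambar" by (rule ordLess_ordLeq_trans[OF \<mu>(2) \<theta>])
  then obtain s :: "'a rel" where s: "Card_order s" "s =o \<mu>"
    using cardinal_copy[OF \<mu>(1) _ ordLess_imp_ordLeq] least unfolding is_least_card_def by blast
  have "lambar i \<le>o s \<longleftrightarrow> lambar i \<le>o \<mu>" for i
    using ordLeq_ordIso_trans[OF _ s(2)] ordLeq_ordIso_trans[OF _ ordIso_symmetric[OF s(2)]] by blast
  then have "?Q s" using pos by (simp add: positive_sets_def)
  then have "liminf_card K J lambar \<le>o s" using least s(1) by (simp add: is_least_card_def)
  then show False
    using ordLess_ordLeq_trans[OF ordIso_ordLess_trans[OF s(2) less]] ordLess_irreflexive by blast
qed

lemma directed_if_all_factors_large:
  assumes "regular_product K lambar" and J: "ideal_on K J" and \<theta>: "Card_order \<theta>"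
    and large: "\<And>i. i \<in> K \<Longrightarrow> \<theta> <o lambar i"
  shows "directed_card (card_prod K lambar) (le_mod K lambar J) (cardSuc \<theta>)"
  unfolding directed_card_def
proof (intro allI impI)
  interpret regular_product K lambar by fact
  fix A assume A: "A \<subseteq> Prod \<and> |A| <o cardSuc \<theta>"
  then have "|A| \<le>o \<theta>" using cardSuc_ordLeq_ordLess[OF \<theta> card_of_Card_order] by blast
  then have small: "|A| <o lambar i" if "i \<in> K" for i
    by (rule ordLeq_ordLess_trans[OF _ large[OF that]])
  obtain u where "u \<in> Prod" "\<forall>i\<in>K. |A| <o lambar i \<longrightarrow> (\<forall>f\<in>A. (f i, u i) \<in> lambar i)"
    using pointwise_bound A by blast
  then show "\<exists>u\<in>Prod. \<forall>f\<in>A. le J f u"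
    using small by (intro bexI[of _ u] ballI le_if_pointwise[OF J]) auto
qed

section \<open>The structure theorem for the pcf ideals\<close>

theorem lemma1p8:
  fixes \<kappa> :: "'k rel" and lambar :: "'k \<Rightarrow> 'a rel" and I :: "'k set set"
    and \<theta> :: "'t rel" and lam :: "'c rel"
  defines "K \<equiv> Field \<kappa>"
  assumes "Card_order \<kappa>" and "infinite K"
    and "\<And>i. i \<in> K \<Longrightarrow> Card_order (lambar i) \<and> infinite (Field (lambar i)) \<and> regularCard (lambar i)"
    and "proper_ideal_on K I"
    and "Card_order \<theta>"
    and "((\<forall>i\<in>K. \<theta> <o lambar i) \<and> wsat K I \<le>o \<theta>) \<or>
         (\<theta> \<le>o liminf_card K I lambar \<and> wsat K I \<le>o \<theta> \<and>
          directed_card (card_prod K lambar) (le_mod K lambar I) (cardSuc \<theta>))"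
    and "Card_order lam" and "infinite (Field lam)"
  shows
    "(\<forall>B \<in> J_leq K I lambar lam - J_less K I lambar lam.
        is_least_card
          (has_true_cofinality (card_prod B lambar)
            (le_mod B lambar (J_less K I lambar lam)) (less_mod B lambar (J_less K I lambar lam))) lam \<and>
        regularCard lam) \<and>
     (\<forall>D. ultrafilter_on K D \<and> D \<inter> I = {} \<longrightarrow>
        is_least_card
          (\<lambda>\<mu> :: ('k \<Rightarrow> 'a) rel. infinite (Field \<mu>) \<and> D \<inter> J_leq K I lambar \<mu> \<noteq> {})
          (cf_ultraprod K lambar D)) \<and>
     (limit_card lam \<longrightarrow>
        J_less K I lambar lam =
          (\<Union>\<mu> \<in> {\<mu> :: 'c rel. Card_order \<mu> \<and> \<mu> <o lam}. J_less K I lambar \<mu>)) \<and>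
     J_less K I lambar lam =
       (\<Union>\<mu> \<in> {\<mu> :: 'c rel. Card_order \<mu> \<and> \<mu> <o lam}. J_leq K I lambar \<mu>) \<and>
     (J_leq K I lambar lam \<noteq> J_less K I lambar lam \<longleftrightarrow>
        J_leq K I lambar lam - J_less K I lambar lam \<noteq> {}) \<and>
     (J_leq K I lambar lam - J_less K I lambar lam \<noteq> {} \<longleftrightarrow> lam \<in> pcf K I lambar) \<and>
     (\<forall>\<gamma>' \<in> Field lam. \<forall>A :: 'c \<Rightarrow> 'k set.
        (\<forall>\<gamma> \<in> underS lam \<gamma>'. A \<gamma> \<in> J_leq K I lambar lam) \<longrightarrow>
        (\<exists>B \<in> J_leq K I lambar lam. \<forall>\<gamma> \<in> underS lam \<gamma>'. A \<gamma> - B \<in> J_less K I lambar lam))"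
proof -
  have ideal: "ideal_on K I" using \<open>proper_ideal_on K I\<close> by (simp add: proper_ideal_on_def)
  interpret reg: regular_product K lambar by unfold_locales fact
  have wsat: "wsat K I \<le>o \<theta>"
    using \<open>(\<forall>i\<in>K. \<theta> <o lambar i) \<and> wsat K I \<le>o \<theta> \<or> _\<close> by blast
  have small: "{i \<in> K. lambar i \<le>o \<mu>} \<in> I" if \<mu>: "Card_order \<mu>" "\<mu> <o \<theta>" for \<mu> :: "'t rel"
    using \<open>(\<forall>i\<in>K. \<theta> <o lambar i) \<and> wsat K I \<le>o \<theta> \<or> _\<close>
  proof (elim disjE conjE)
    assume large: "\<forall>i\<in>K. \<theta> <o lambar i"
    have "\<not> lambar i \<le>o \<mu>" if "i \<in> K" for i
      using ordLess_transitive[OF \<mu>(2), of "lambar i"] large that not_ordLess_ordLeq by blast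
    then have *: "{i \<in> K. lambar i \<le>o \<mu>} = {}" by blast
    show ?thesis unfolding * using ideal by (simp add: ideal_on_def)
  next
    assume "\<theta> \<le>o liminf_card K I lambar"
    then show ?thesis
      using small_factors_in_ideal[OF \<open>proper_ideal_on K I\<close> _ _ \<mu>] reg.regular by blast
  qed
  have directed: "directed_card (card_prod K lambar) (le_mod K lambar I) (cardSuc \<theta>)"
    using \<open>(\<forall>i\<in>K. \<theta> <o lambar i) \<and> wsat K I \<le>o \<theta> \<or> _\<close>
      directed_if_all_factors_large[OF reg.regular_product_axioms ideal \<open>Card_order \<theta>\<close>] by blast
  interpret pcf_product K lambar I \<theta>
  proof
    show "{i \<in> K. lambar i \<le>o |underS \<theta> a| } \<in> I" if "a \<in> Field \<theta>" for a
      by (rule small[OF card_of_Card_order card_of_underS[OF \<open>Card_order \<theta>\<close> that]])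
    show False if "\<And>a. a \<in> Field \<theta> \<Longrightarrow> A a \<subseteq> K \<and> A a \<notin> I"
      "\<And>a b. a \<in> Field \<theta> \<Longrightarrow> b \<in> Field \<theta> \<Longrightarrow> a \<noteq> b \<Longrightarrow> A a \<inter> A b = {}" for A
      by (rule wsat_no_disjoint_family[OF ideal wsat that])
  qed (fact ideal \<open>Card_order \<theta>\<close> directed)+
  note lam = \<open>Card_order lam\<close> \<open>infinite (Field lam)\<close>
  show ?thesis
  proof (intro conjI ballI allI impI)
    fix B assume B: "B \<in> J_leq K I lambar lam - J_less K I lambar lam"
    show "is_least_card (has_true_cofinality (card_prod B lambar)
        (le_mod B lambar (J_less K I lambar lam)) (less_mod B lambar (J_less K I lambar lam))) lam"
      by (rule true_cofinality_on_new_set[OF lam B])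
    show "regularCard lam" by (rule regular_if_new_set(1)[OF lam(1) B])
  next
    fix D assume "ultrafilter_on K D \<and> D \<inter> I = {}"
    then show "is_least_card
        (\<lambda>\<mu> :: ('k \<Rightarrow> 'a) rel. infinite (Field \<mu>) \<and> D \<inter> J_leq K I lambar \<mu> \<noteq> {})
        (cf_ultraprod K lambar D)"
      using cf_ultraprod_least by blast
  next
    assume "limit_card lam"
    then show "J_less K I lambar lam =
        (\<Union>\<mu> \<in> {\<mu> :: 'c rel. Card_order \<mu> \<and> \<mu> <o lam}. J_less K I lambar \<mu>)"
      by (rule J_less_limit)
  next
    show "J_less K I lambar lam =
        (\<Union>\<mu> \<in> {\<mu> :: 'c rel. Card_order \<mu> \<and> \<mu> <o lam}. J_leq K I lambar \<mu>)"
      by (rule J_less_eq_Union_J_leq[OF lam])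
  next
    show "J_leq K I lambar lam \<noteq> J_less K I lambar lam \<longleftrightarrow>
        J_leq K I lambar lam - J_less K I lambar lam \<noteq> {}"
      using J_less_subset_J_leq[OF lam(1)] by blast
  next
    show "J_leq K I lambar lam - J_less K I lambar lam \<noteq> {} \<longleftrightarrow> lam \<in> pcf K I lambar"
      by (rule new_set_iff_in_pcf[OF lam(1)])
  next
    fix \<gamma>' and A :: "'c \<Rightarrow> 'k set"
    assume "\<gamma>' \<in> Field lam" and A: "\<forall>\<gamma>\<in>underS lam \<gamma>'. A \<gamma> \<in> J_leq K I lambar lam"
    then have "|underS lam \<gamma>'| <o lam" by (intro card_of_underS[OF lam(1)])
    then show "\<exists>B\<in>J_leq K I lambar lam. \<forall>\<gamma>\<in>underS lam \<gamma>'. A \<gamma> - B \<in> J_less K I lambar lam"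
      by (rule J_leq_directed_mod_J_less[OF lam]) (use A in blast)
  qed
qed

end
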